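(* For every fixed integer $t\geq 3$, one has $P_t(U)=U-o(U)$ as $U\to\infty$ (that is, $\lim_{U\to\infty}P_t(U)/U=1$) if and only if $3\leq t\leq 5$.
   Context: For a finite set $A=\{a_1<\cdots<a_t\}\subset\mathbb Z$, write $\Delta^+(A)=\{a_j-a_i:1\leq i<j\leq t\}$. The set $A$ is a $t$-mark Golomb ruler if all these positive differences $a_j-a_i$ ($1\le i<j\le t$) are distinct, i.e. $|\Delta^+(A)|=\binom t2$. For an integer $U\geq 1$, $P_t(U)$ denotes the maximum of $\left|\bigcup_{i=1}^{b}\Delta^+(A_i)\right|$ over all finite families $A_1,\dots,A_b$ (including the empty family) of $t$-mark Golomb rulers for which the sets $\Delta^+(A_i)$ are pairwise disjoint and contained in $[1,U]$. Here $[1,U]$ is the set of integers from $1$ to $U$, and $U$ ranges over positive integers. *)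

theory Defs
  imports Complex_Main "HOL-Library.Disjoint_Sets"
begin

definition pos_diffs :: "int set \<Rightarrow> int set" where
  "pos_diffs A = {y - x | x y. x \<in> A \<and> y \<in> A \<and> x < y}"

definition golomb_ruler :: "nat \<Rightarrow> int set \<Rightarrow> bool" where
  "golomb_ruler t A \<longleftrightarrow>
     finite A \<and> card A = t \<and>
     inj_on (\<lambda>(x, y). y - x) {(x, y). x \<in> A \<and> y \<in> A \<and> x < y}"

(* The family is A 1, ..., A b; the values of A outside {1..b} are irrelevant,
   and b = 0 gives the empty family. *)
definition ruler_packing :: "nat \<Rightarrow> nat \<Rightarrow> nat \<Rightarrow> (nat \<Rightarrow> int set) \<Rightarrow> bool" where
  "ruler_packing t U b A \<longleftrightarrow>
     (\<forall>i\<in>{1..b}. golomb_ruler t (A i) \<and> pos_diffs (A i) \<subseteq> {1..int U}) \<and>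
     disjoint_family_on (\<lambda>i. pos_diffs (A i)) {1..b}"

definition max_covered :: "nat \<Rightarrow> nat \<Rightarrow> nat" where
  "max_covered t U = Max {card (\<Union>i\<in>{1..b}. pos_diffs (A i)) | b A. ruler_packing t U b A}"

(* The maximum above is taken over a finite nonempty set. *)
lemma max_covered_well_defined:
  shows "finite {card (\<Union>i\<in>{1..b}. pos_diffs (A i)) | b A. ruler_packing t U b A}" (is "finite ?S")
    and "{card (\<Union>i\<in>{1..b}. pos_diffs (A i)) | b A. ruler_packing t U b A} \<noteq> {}"
proof -
  have "?S \<subseteq> {..U}"
  proof clarsimp
    fix b A assume "ruler_packing t U b A"
    then have "(\<Union>i\<in>{1..b}. pos_diffs (A i)) \<subseteq> {1..int U}"
      unfolding ruler_packing_def by blast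
    then have "card (\<Union>i\<in>{1..b}. pos_diffs (A i)) \<le> card {1..int U}"
      by (intro card_mono) auto
    then show "card (\<Union>i\<in>{Suc 0..b}. pos_diffs (A i)) \<le> U" by simp
  qed
  then show "finite ?S" by (rule finite_subset) simp
  have "ruler_packing t U 0 (\<lambda>_. {})"
    by (simp add: ruler_packing_def disjoint_family_on_def)
  then show "?S \<noteq> {}" by blast
qed

lemma card_increasing_pairs:
  fixes A :: "int set"
  assumes "finite A"
  shows "card {(x, y). x \<in> A \<and> y \<in> A \<and> x < y} = card A choose 2"
proof -
  let ?P = "{(x, y). x \<in> A \<and> y \<in> A \<and> x < y}"
  have "bij_betw (\<lambda>(x, y). {x, y}) ?P {B. B \<subseteq> A \<and> card B = 2}"
    unfolding bij_betw_def
  proof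
    show "inj_on (\<lambda>(x, y). {x, y}) ?P"
      by (auto simp: inj_on_def doubleton_eq_iff)
    show "(\<lambda>(x, y). {x, y}) ` ?P = {B. B \<subseteq> A \<and> card B = 2}"
    proof (intro equalityI subsetI)
      fix B assume "B \<in> {B. B \<subseteq> A \<and> card B = 2}"
      then obtain x y where B: "B = {x, y}" "x \<noteq> y" "x \<in> A" "y \<in> A"
        by (auto simp: card_2_iff)
      then consider "x < y" | "y < x" by linarith
      then show "B \<in> (\<lambda>(x, y). {x, y}) ` ?P"
        using B by cases (force simp: insert_commute)+
    qed auto
  qed
  then have "card ?P = card {B. B \<subseteq> A \<and> card B = 2}" by (rule bij_betw_same_card)
  then show ?thesis using n_subsets[OF assms] by simp
qed

lemma golomb_ruler_iff_card:
  "golomb_ruler t A \<longleftrightarrow> finite A \<and> card A = t \<and> card (pos_diffs A) = t choose 2"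
proof (cases "finite A")
  case True
  let ?P = "{(x, y). x \<in> A \<and> y \<in> A \<and> x < y}"
  have fin: "finite ?P"
    by (rule finite_subset[of _ "A \<times> A"]) (use True in auto)
  have img: "pos_diffs A = (\<lambda>(x, y). y - x) ` ?P"
    by (force simp: pos_diffs_def)
  show ?thesis
    unfolding golomb_ruler_def img inj_on_iff_eq_card[OF fin]
    using card_increasing_pairs[OF True] by auto
qed (simp add: golomb_ruler_def)

end

(* Upper bound, t >= 6. In a ruler the t - 1 gaps and the t - 2 sums of two consecutive gaps add up to
   exactly the sum of its three longest differences. If the differences of a packing were almost all of
   [1, U], the former sum would be at least that of the smallest values, in proportion (2t - 3)/(t choose 2),
   and the latter at most that of the largest values, in proportion 3/(t choose 2). For t >= 7 this is
   contradictory. For t = 6 both bounds agree, so in almost every ruler the nine short, three middle and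
   three long differences lie in [0, 3U/5], [3U/5, 4U/5], [4U/5, U]. Such a ruler has n1 differences in
   [U/5, 2U/5] and n2 in [2U/5, 3U/5] with n1 + 3 n2 <= 11, whereas uniform covering needs 12 on average.

   Lower bound, t <= 5. Call a family of rulers a difference family mod m if its signed differences and 0
   form a complete residue system without repetition. Families mod m and mod n yield one mod m n: blow up
   each difference d of the first to n d + r, where r runs over the differences of the second and 0, its
   marks being relabelled by a sharply 2-transitive set of permutations. Start from a power of a family
   whose differences fill an interval [-W, W], v = 2W + 1, and multiply it by families mod v^i w^j with
   w coprime to v; the ratio of consecutive numbers v^i w^j tends to 1. *)
theory Submission
  imports Defs "HOL-Analysis.Kronecker_Approximation_Theorem"
begin

section \<open>Difference families\<close>

text \<open>Rulers are indexed by functions rather than sets so that marks can be relabelled by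
  composition; only the values below \<open>t\<close> matter. Inserting 0 makes the empty family a
  difference family mod 1, the unit of the product construction.\<close>

definition diffs :: "nat \<Rightarrow> (nat \<Rightarrow> int) set \<Rightarrow> int set" where
  "diffs t G = insert 0 {a j - a i | a i j. a \<in> G \<and> i < t \<and> j < t}"

text \<open>There are at most \<open>m - 1\<close> ordered pairs of distinct marks, so covering all residues
  forces their differences to be distinct and nonzero mod \<open>m\<close>.\<close>

definition diff_family :: "nat \<Rightarrow> nat \<Rightarrow> (nat \<Rightarrow> int) set \<Rightarrow> bool" where
  "diff_family t m G \<longleftrightarrow> finite G \<and> card G * (t * (t - 1)) < m \<and>
     (\<forall>x. \<exists>d\<in>diffs t G. int m dvd x - d)"

lemma diffsE:
  assumes "d \<in> diffs t G" "d \<noteq> 0"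
  obtains a i j where "a \<in> G" "i < t" "j < t" "i \<noteq> j" "d = a j - a i"
  using assms unfolding diffs_def by fastforce

lemma diffsI: "a \<in> G \<Longrightarrow> i < t \<Longrightarrow> j < t \<Longrightarrow> a j - a i \<in> diffs t G"
  unfolding diffs_def by blast

lemma zero_in_diffs: "0 \<in> diffs t G"
  by (simp add: diffs_def)

lemma card_off_diagonal:
  "finite {(i, j). i < t \<and> j < t \<and> i \<noteq> j}" "card {(i, j). i < t \<and> j < t \<and> i \<noteq> (j::nat)} = t * (t - 1)"
proof -
  have eq: "{(i, j). i < t \<and> j < t \<and> i \<noteq> j} = {..<t} \<times> {..<t} - (\<lambda>i. (i, i)) ` {..<t}"
    by auto
  show "finite {(i, j). i < t \<and> j < t \<and> i \<noteq> j}"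
    unfolding eq by simp
  have "card {(i, j). i < t \<and> j < t \<and> i \<noteq> j} = t * t - t"
    unfolding eq by (subst card_Diff_subset) (auto simp: card_image inj_on_def)
  then show "card {(i, j). i < t \<and> j < t \<and> i \<noteq> j} = t * (t - 1)"
    by (simp add: algebra_simps)
qed

lemma diff_family_inj:
  assumes "diff_family t m G"
  defines "D \<equiv> G \<times> {(i, j). i < t \<and> j < t \<and> i \<noteq> j}" and "g \<equiv> \<lambda>(a :: nat \<Rightarrow> int, i, j). a j - a i"
  shows "inj_on g D" "0 \<notin> g ` D"
proof -
  define h where "h = (\<lambda>d. g d mod int m)"
  have fin: "finite G" and cG: "card G * (t * (t - 1)) < m"
    using assms(1) by (auto simp: diff_family_def)
  have finD: "finite D"
    unfolding D_def using fin card_off_diagonal by (intro finite_cartesian_product) auto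
  have cD: "card D = card G * (t * (t - 1))"
    unfolding D_def by (simp add: card_cartesian_product card_off_diagonal)
  have surj: "{1..<int m} \<subseteq> h ` D - {0}"
  proof
    fix x assume x: "x \<in> {1..<int m}"
    obtain d where d: "d \<in> diffs t G" "int m dvd x - d"
      using assms(1) unfolding diff_family_def by blast
    then have e: "d mod int m = x"
      using x by (metis atLeastLessThan_iff mod_eq_dvd_iff mod_pos_pos_trivial order.trans zero_le_one)
    with x have "d \<noteq> 0"
      by auto
    then obtain a i j where "a \<in> G" "i < t" "j < t" "i \<noteq> j" "d = a j - a i"
      using d diffsE by metis
    then show "x \<in> h ` D - {0}"
      using e x by (auto simp: h_def g_def D_def intro!: image_eqI[of _ _ "(a, i, j)"])
  qed
  have "card {1..<int m} \<le> card (h ` D - {0})"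
    using surj finD by (intro card_mono) auto
  then have c: "m - 1 \<le> card (h ` D - {0})"
    by simp
  also have c2: "\<dots> \<le> card (h ` D)"
    using finD by (intro card_mono) auto
  finally have c3: "m - 1 \<le> card (h ` D)" .
  have c4: "card (h ` D) \<le> card D"
    using finD by (rule card_image_le)
  have "card D \<le> m - 1"
    using cG cD by simp
  \<comment> \<open>The chain from \<open>m - 1\<close> up to \<open>card D\<close> and back to
    \<open>m - 1\<close> collapses: reduction mod \<open>m\<close> is injective on index triples and
    misses 0. Both facts then descend to the integers.\<close>
  then have eq: "card (h ` D) = card D" "card (h ` D - {0}) = card (h ` D)"
    using c c2 c3 c4 by linarith+
  then have "inj_on h D"
    using finD by (intro eq_card_imp_inj_on)
  then show "inj_on g D"
    by (auto simp: inj_on_def h_def)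
  have "0 \<notin> h ` D"
    using eq(2) finD by (metis card_Diff1_less finite_imageI less_irrefl)
  then show "0 \<notin> g ` D"
    by (force simp: h_def)
qed

section \<open>From difference families to ruler packings\<close>

lemma max_covered_ge:
  assumes "ruler_packing t U b A"
  shows "card (\<Union>i\<in>{1..b}. pos_diffs (A i)) \<le> max_covered t U"
  unfolding max_covered_def using max_covered_well_defined(1)[of t U] assms by (intro Max_ge) blast+

text \<open>Distinctness of all signed integer differences serves twice: within one member it makes
  the marks a Golomb ruler, and across members it makes the difference sets disjoint. Their union is
  exactly the positive half of \<open>diffs t F\<close>.\<close>

lemma diff_family_packing:
  assumes fam: "diff_family t m F" and bound: "diffs t F \<subseteq> {- int U..int U}"
  shows "card (diffs t F \<inter> {1..}) \<le> max_covered t U"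
proof -
  have fin: "finite F"
    using fam by (simp add: diff_family_def)
  have injD: "a = a' \<and> i = i' \<and> j = j'"
    if "a j - a i = a' j' - a' i'" "a \<in> F" "a' \<in> F" "i < t" "j < t" "i \<noteq> j" "i' < t" "j' < t" "i' \<noteq> j'"
    for a a' i i' j j'
    using inj_onD[OF diff_family_inj(1)[OF fam], of "(a, i, j)" "(a', i', j')"] that by auto
  have inja: "inj_on a {..<t}" if "a \<in> F" for a
  proof (rule inj_onI, rule ccontr)
    fix i j assume "i \<in> {..<t}" "j \<in> {..<t}" "a i = a j" "i \<noteq> j"
    then have "0 \<in> (\<lambda>(a, i, j). a j - a i) ` (F \<times> {(i, j). i < t \<and> j < t \<and> i \<noteq> j})"
      using that by (intro image_eqI[of _ _ "(a, i, j)"]) auto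
    then show False
      using diff_family_inj(2)[OF fam] by blast
  qed
  obtain e where e: "bij_betw e {1..card F} F"
    using ex_bij_betw_nat_finite_1[OF fin] by blast
  define A where "A = (\<lambda>k. e k ` {..<t})"
  have eF: "e k \<in> F" if "k \<in> {1..card F}" for k
    using e that by (auto simp: bij_betw_def)
  have pd: "\<exists>i j. x = e k j - e k i \<and> i < t \<and> j < t \<and> i \<noteq> j \<and> x > 0" if "x \<in> pos_diffs (A k)" for x k
    using that by (fastforce simp: pos_diffs_def A_def)
  have sub: "pos_diffs (A k) \<subseteq> diffs t F \<inter> {1..}" if "k \<in> {1..card F}" for k
  proof
    fix x assume "x \<in> pos_diffs (A k)"
    then show "x \<in> diffs t F \<inter> {1..}"
      using pd[of x k] diffsI[OF eF[OF that]] by auto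
  qed
  have gol: "golomb_ruler t (A k)" if "k \<in> {1..card F}" for k
    unfolding golomb_ruler_def
  proof (intro conjI)
    show "card (A k) = t"
      using inja[OF eF[OF that]] by (simp add: A_def card_image)
    show "inj_on (\<lambda>(x, y). y - x) {(x, y). x \<in> A k \<and> y \<in> A k \<and> x < y}"
    proof (rule inj_onI)
      fix p q
      assume p: "p \<in> {(x, y). x \<in> A k \<and> y \<in> A k \<and> x < y}"
        and q: "q \<in> {(x, y). x \<in> A k \<and> y \<in> A k \<and> x < y}"
        and eq: "(\<lambda>(x, y). y - x) p = (\<lambda>(x, y). y - x) q"
      obtain i j where ij: "p = (e k i, e k j)" "i < t" "j < t" "e k i < e k j"
        using p unfolding A_def by auto
      obtain i' j' where ij': "q = (e k i', e k j')" "i' < t" "j' < t" "e k i' < e k j'"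
        using q unfolding A_def by auto
      have ne: "i \<noteq> j" "i' \<noteq> j'"
        using ij(4) ij'(4) by auto
      have "e k j - e k i = e k j' - e k i'"
        using eq ij(1) ij'(1) by simp
      then have "i = i' \<and> j = j'"
        using injD[OF _ eF[OF that] eF[OF that] ij(2,3) ne(1) ij'(2,3) ne(2)] by blast
      then show "p = q"
        using ij ij' by simp
    qed
  qed (simp add: A_def)
  have "disjoint_family_on (\<lambda>k. pos_diffs (A k)) {1..card F}"
    unfolding disjoint_family_on_def
  proof (intro ballI impI)
    fix k l assume kl: "k \<in> {1..card F}" "l \<in> {1..card F}" "k \<noteq> l"
    have "e k \<noteq> e l"
      using e kl unfolding bij_betw_def inj_on_def by blast
    moreover have "e k = e l" if x: "x \<in> pos_diffs (A k)" "x \<in> pos_diffs (A l)" for x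
    proof -
      obtain i j where ij: "x = e k j - e k i" "i < t" "j < t" "i \<noteq> j"
        using pd[OF x(1)] by blast
      obtain i' j' where ij': "x = e l j' - e l i'" "i' < t" "j' < t" "i' \<noteq> j'"
        using pd[OF x(2)] by blast
      show ?thesis
        using injD[OF _ eF[OF kl(1)] eF[OF kl(2)] ij(2-4) ij'(2-4)] ij(1) ij'(1) by simp
    qed
    ultimately show "pos_diffs (A k) \<inter> pos_diffs (A l) = {}"
      by blast
  qed
  moreover have "pos_diffs (A k) \<subseteq> {1..int U}" if "k \<in> {1..card F}" for k
    using order.trans[OF sub[OF that] Int_mono[OF bound order_refl]] by force
  ultimately have pack: "ruler_packing t U (card F) A"
    unfolding ruler_packing_def using gol by blast
  have "diffs t F \<inter> {1..} \<subseteq> (\<Union>k\<in>{1..card F}. pos_diffs (A k))"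
  proof
    fix x assume x: "x \<in> diffs t F \<inter> {1..}"
    then have "x \<in> diffs t F" "x \<noteq> 0"
      by auto
    then obtain a i j where a: "a \<in> F" "i < t" "j < t" "i \<noteq> j" "x = a j - a i"
      by (rule diffsE)
    moreover have "a \<in> e ` {1..card F}"
      using e a(1) by (simp add: bij_betw_def)
    then obtain k where k: "k \<in> {1..card F}" "e k = a"
      by blast
    ultimately have "x \<in> pos_diffs (A k)" 
      using x unfolding pos_diffs_def A_def by fastforce
    then show "x \<in> (\<Union>k\<in>{1..card F}. pos_diffs (A k))"
      using k by blast
  qed
  then have "(\<Union>k\<in>{1..card F}. pos_diffs (A k)) = diffs t F \<inter> {1..}"
    using sub by blast
  then show ?thesis
    using max_covered_ge[OF pack] by simp
qed

section \<open>Products of difference families\<close>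

text \<open>The cardinality bound forces the set to be sharply 2-transitive.\<close>

definition two_transitive :: "nat \<Rightarrow> (nat \<Rightarrow> nat) set \<Rightarrow> bool" where
  "two_transitive t S \<longleftrightarrow> finite S \<and> card S \<le> t * (t - 1) \<and> (\<forall>\<sigma>\<in>S. \<forall>i<t. \<sigma> i < t) \<and>
     (\<forall>i<t. \<forall>j<t. \<forall>k<t. \<forall>l<t. i \<noteq> j \<longrightarrow> k \<noteq> l \<longrightarrow> (\<exists>\<sigma>\<in>S. \<sigma> i = k \<and> \<sigma> j = l))"

text \<open>Digit expansion: \<open>y\<close> is the residue mod \<open>n\<close> and
  \<open>x\<close> the residue of the quotient mod \<open>m\<close>. The set of differences is
  determined over the integers, not only mod \<open>m * n\<close>, because the later arguments
  control the size of the differences.\<close>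

lemma diff_family_product:
  assumes F: "diff_family t m F" and G: "diff_family t n G" and S: "two_transitive t S"
  shows "\<exists>H. diff_family t (m * n) H \<and>
    diffs t H = {int n * x + y | x y. x \<in> diffs t F \<and> y \<in> diffs t G}" (is "\<exists>H. _ \<and> _ = ?R")
proof -
  \<comment> \<open>The offsets added to a blown-up ruler of \<open>F\<close>. If \<open>x\<close>
    is the difference at indices \<open>i\<close>, \<open>j\<close>, some offset must have
    difference \<open>y\<close> there: the zero offset serves \<open>y = 0\<close>, and a relabelled
    ruler of \<open>G\<close> serves any other \<open>y\<close>.\<close>
  define M where "M = insert (\<lambda>_. 0) ((\<lambda>(c, \<sigma>). c \<circ> \<sigma>) ` (G \<times> S))"
  \<comment> \<open>The unscaled copy of \<open>G\<close> produces the differences with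
    \<open>x = 0\<close>.\<close>
  define H where "H = (\<lambda>(a, f) i. int n * a i + f i) ` (F \<times> M) \<union> G"
  have fin: "finite F" "finite G" "finite S"
    and cF: "card F * (t * (t - 1)) < m" and cG: "card G * (t * (t - 1)) < n"
    and cS: "card S \<le> t * (t - 1)"
    using F G S by (auto simp: diff_family_def two_transitive_def)
  have finM: "finite M"
    using fin by (simp add: M_def)
  have "card M \<le> Suc (card (G \<times> S))"
    unfolding M_def using fin card_image_le[of "G \<times> S" "\<lambda>(c, \<sigma>). c \<circ> \<sigma>"]
    by (intro card_insert_le_m1) auto
  also have "\<dots> \<le> Suc (card G * (t * (t - 1)))"
    using cS by (simp add: card_cartesian_product)
  also have "\<dots> \<le> n"
    using cG by simp
  finally have cM: "card M \<le> n" .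
  have "card H \<le> card (F \<times> M) + card G"
    unfolding H_def using fin finM
    by (intro order.trans[OF card_Un_le] add_mono card_image_le) auto
  then have "card H \<le> card F * card M + card G"
    by (simp add: card_cartesian_product)
  then have "card H * (t * (t - 1)) \<le> (card F * card M + card G) * (t * (t - 1))"
    by (rule mult_right_mono) simp
  also have "\<dots> = card F * (t * (t - 1)) * card M + card G * (t * (t - 1))"
    by (simp add: algebra_simps)
  \<comment> \<open>With \<open>T = t * (t - 1)\<close>: since \<open>card M \<le> n\<close> and
    \<open>card G * T < n\<close>, the count stays below \<open>(card F * T + 1) * n\<close>, hence
    below \<open>m * n\<close>.\<close>
  also have "\<dots> < card F * (t * (t - 1)) * n + n"
    using cG cM by (intro add_le_less_mono mult_left_mono) auto
  also have "\<dots> = Suc (card F * (t * (t - 1))) * n"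
    by simp
  also have "\<dots> \<le> m * n"
    using cF by (intro mult_right_mono) auto
  finally have cH: "card H * (t * (t - 1)) < m * n" .
  have "?R \<subseteq> diffs t H"
  proof clarsimp
    fix x y assume xy: "x \<in> diffs t F" "y \<in> diffs t G"
    show "int n * x + y \<in> diffs t H"
    proof (cases "x = 0")
      case True
      then show ?thesis
        using xy(2) unfolding diffs_def H_def by auto
    next
      case False
      then obtain a i j where a: "a \<in> F" "i < t" "j < t" "i \<noteq> j" "x = a j - a i"
        using diffsE xy by metis
      have "\<exists>f\<in>M. f j - f i = y"
      proof (cases "y = 0")
        case True
        then show ?thesis
          by (auto simp: M_def)
      next
        case False
        then obtain c k l where c: "c \<in> G" "k < t" "l < t" "k \<noteq> l" "y = c l - c k"
          using diffsE xy by metis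
        then obtain \<sigma> where \<sigma>: "\<sigma> \<in> S" "\<sigma> i = k" "\<sigma> j = l"
          using S a unfolding two_transitive_def by meson
        then have "c \<circ> \<sigma> \<in> M"
          using c unfolding M_def by force
        then show ?thesis
          using \<sigma> c by (intro bexI[of _ "c \<circ> \<sigma>"]) auto
      qed
      then obtain f where f: "f \<in> M" "f j - f i = y"
        by blast
      have "(\<lambda>i. int n * a i + f i) \<in> H"
        using a f unfolding H_def by force
      from diffsI[OF this a(2,3)] show ?thesis
        unfolding a(5) f(2)[symmetric] by (simp add: algebra_simps)
    qed
  qed
  moreover have "diffs t H \<subseteq> ?R"
  proof
    fix z assume "z \<in> diffs t H"
    then consider "z \<in> diffs t G" | a f i j where "a \<in> F" "f \<in> M" "i < t" "j < t"
      "z = (int n * a j + f j) - (int n * a i + f i)"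
      unfolding diffs_def H_def by fastforce
    then show "z \<in> ?R"
    proof cases
      case 1
      then show ?thesis
        using zero_in_diffs[of t F] by force
    next
      case 2
      have "f j - f i \<in> diffs t G"
        using 2 S zero_in_diffs[of t G] diffsI[of _ G _ t] unfolding M_def two_transitive_def by auto
      moreover have "z = int n * (a j - a i) + (f j - f i)"
        using 2 by (simp add: algebra_simps)
      ultimately show ?thesis
        using diffsI[of a F i t j] 2 by blast
    qed
  qed
  ultimately have eq: "diffs t H = ?R"
    by blast
  have "\<exists>d\<in>diffs t H. int (m * n) dvd x - d" for x
  proof -
    obtain y k where y: "y \<in> diffs t G" "x - y = int n * k"
      using G unfolding diff_family_def dvd_def by blast
    obtain w l where w: "w \<in> diffs t F" "k - w = int m * l"
      using F unfolding diff_family_def dvd_def by blast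
    have "x - (int n * w + y) = int n * (k - w)"
      using y by (simp add: algebra_simps)
    also have "\<dots> = int (m * n) * l"
      using w by simp
    finally have "int (m * n) dvd x - (int n * w + y)"
      by simp
    then show ?thesis
      using y w unfolding eq by blast
  qed
  then show ?thesis
    using cH eq fin finM unfolding diff_family_def by (intro exI[of _ H]) (simp add: H_def)
qed

section \<open>Density of products of powers\<close>

text \<open>Two combinations \<open>lo\<close> and \<open>lo + d\<close> with
  \<open>0 < d < \<epsilon>\<close> suffice: replacing copies of \<open>lo\<close> by
  \<open>lo + d\<close> one at a time gives a ladder of step \<open>d\<close>, and once it is longer
  than \<open>x\<close>, its translates by multiples of \<open>x\<close> cover everything beyond its
  start.\<close>

lemma linear_combinations_eventually_dense:
  fixes x y \<epsilon> :: real
  assumes x: "x > 0" and y: "y > 0" and \<epsilon>: "\<epsilon> > 0"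
    and indep: "\<And>p q :: nat. p > 0 \<Longrightarrow> q > 0 \<Longrightarrow> real p * x \<noteq> real q * y"
  shows "\<exists>R. \<forall>z\<ge>R. \<exists>(i::nat) (j::nat). i * x + j * y \<le> z \<and> z < i * x + j * y + \<epsilon>"
proof -
  obtain N :: nat where N: "N > 0" "y / N < \<epsilon>"
  proof -
    obtain N :: nat where "real N > y / \<epsilon>"
      using reals_Archimedean2 by blast
    moreover from this have "N > 0"
      using y \<epsilon> by (cases N) (auto simp: field_simps)
    ultimately show thesis
      using that[of N] \<epsilon> by (auto simp: field_simps)
  qed
  \<comment> \<open>Dirichlet approximation of \<open>x / y\<close> makes \<open>p * x\<close> and
    \<open>q * y\<close> differ by less than \<open>y / N < \<epsilon>\<close>; by
    \<open>indep\<close> they are not equal.\<close>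
  obtain h k where hk: "0 < k" "\<bar>of_int k * (x / y) - of_int h\<bar> < 1 / N"
    using Dirichlet_approx[OF N(1), of "x / y"] by metis
  have "of_int h > (- 1 :: real)"
  proof -
    have "1 / real N \<le> 1"
      using N by simp
    moreover have "of_int k * (x / y) > 0"
      using hk x y by simp
    ultimately show ?thesis
      using hk(2) by linarith
  qed
  then have "h \<ge> 0"
    by linarith
  define p q where "p = nat k" and "q = nat h"
  have p: "p > 0" and kp: "real_of_int k = p" and hq: "real_of_int h = q"
    using hk \<open>h \<ge> 0\<close> by (auto simp: p_def q_def)
  have "\<bar>p * x - q * y\<bar> = \<bar>of_int k * (x / y) - of_int h\<bar> * y"
    using y unfolding kp hq by (simp add: abs_mult_pos[symmetric] field_simps)
  also have "\<dots> < 1 / N * y"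
    using hk y by (intro mult_strict_right_mono) auto
  finally have close: "\<bar>p * x - q * y\<bar> < \<epsilon>"
    using N by simp
  have ne: "p * x \<noteq> q * y"
    using indep[OF p, of q] p x by (cases "q = 0") auto
  have "\<exists>(p1::nat) (q1::nat) (p2::nat) (q2::nat). p1 * x + q1 * y < p2 * x + q2 * y \<and>
          p2 * x + q2 * y < p1 * x + q1 * y + \<epsilon>"
  proof (cases "p * x < q * y")
    case True
    then show ?thesis
      using close by (rule_tac exI[of _ p], rule_tac exI[of _ 0], rule_tac exI[of _ 0], rule_tac exI[of _ q]) auto
  next
    case False
    then show ?thesis
      using close ne by (rule_tac exI[of _ 0], rule_tac exI[of _ q], rule_tac exI[of _ p], rule_tac exI[of _ 0]) auto
  qed
  then obtain p1 q1 p2 q2 :: nat where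
    "p1 * x + q1 * y < p2 * x + q2 * y" "p2 * x + q2 * y < p1 * x + q1 * y + \<epsilon>"
    by blast
  then obtain lo d where lo: "lo = p1 * x + q1 * y" and d: "lo + d = p2 * x + q2 * y" "0 < d" "d < \<epsilon>"
    by (metis add_diff_cancel_left' add_diff_eq diff_gt_0_iff_gt less_diff_eq add.commute)
  \<comment> \<open>\<open>n\<close> rungs of height \<open>d\<close> span a full period
    \<open>x\<close>.\<close>
  obtain n :: nat where n: "n * d > x"
    using reals_Archimedean3[OF d(2)] by blast
  have "\<exists>(i::nat) (j::nat). i * x + j * y \<le> z \<and> z < i * x + j * y + \<epsilon>" if z: "z \<ge> n * lo" for z
  proof -
    define m where "m = nat \<lfloor>(z - n * lo) / x\<rfloor>"
    define z' where "z' = z - n * lo - m * x"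
    have "real m = of_int \<lfloor>(z - n * lo) / x\<rfloor>"
      using z x by (simp add: m_def)
    then have "real m \<le> (z - n * lo) / x" "(z - n * lo) / x < real m + 1"
      by linarith+
    then have z': "0 \<le> z'" "z' < x"
      using x by (auto simp: z'_def field_simps)
    define k where "k = nat \<lfloor>z' / d\<rfloor>"
    have "real k = of_int \<lfloor>z' / d\<rfloor>"
      using z' d by (simp add: k_def)
    then have "real k \<le> z' / d" "z' / d < real k + 1"
      by linarith+
    then have k: "k * d \<le> z'" "z' < k * d + d"
      using d by (auto simp: field_simps)
    have "k * d < n * d"
      using k z' n by linarith
    then have kn: "k \<le> n"
      using d by simp
    obtain c where c: "n = c + k"
      using kn by (metis le_add_diff_inverse2)
    \<comment> \<open>\<open>k\<close> copies of the higher combination and \<open>c = n - k\<close>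
      of the lower one, shifted by \<open>m\<close> copies of \<open>x\<close>; all coefficients
      stay nonnegative because \<open>k \<le> n\<close>.\<close>
    define i j where "i = m + c * p1 + k * p2" and "j = c * q1 + k * q2"
    have "i * x + j * y = m * x + c * (p1 * x + q1 * y) + k * (p2 * x + q2 * y)"
      by (simp add: i_def j_def algebra_simps)
    also have "\<dots> = m * x + (real n - real k) * lo + k * (lo + d)"
      by (simp add: lo[symmetric] d(1)[symmetric] c)
    also have "\<dots> = z - z' + k * d"
      by (simp add: z'_def algebra_simps)
    finally show ?thesis
      using k d by (rule_tac exI[of _ i], rule_tac exI[of _ j]) linarith
  qed
  then show ?thesis
    by blast
qed

text \<open>Take logarithms: an additive gap of \<open>- ln (1 - \<delta>)\<close> is a
  multiplicative factor \<open>1 - \<delta>\<close>. A relation between \<open>ln v\<close> and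
  \<open>ln w\<close> would give \<open>v ^ p = w ^ q\<close>, against coprimality.\<close>

lemma coprime_powers_eventually_dense:
  fixes v w :: nat and \<delta> :: real
  assumes v: "v > 1" and w: "w > 1" and "coprime v w" and \<delta>: "0 < \<delta>" "\<delta> < 1"
  shows "\<exists>R. \<forall>n\<ge>R. \<exists>i j. v ^ i * w ^ j \<le> n \<and> (1 - \<delta>) * real n < real (v ^ i * w ^ j)"
proof -
  have "real p * ln v \<noteq> real q * ln w" if "p > 0" "q > 0" for p q :: nat
  proof
    assume "real p * ln v = real q * ln w"
    then have "ln (real v ^ p) = ln (real w ^ q)"
      using v w by (simp add: ln_realpow)
    then have "real v ^ p = real w ^ q"
      using v w by simp
    then have "v ^ p = w ^ q"
      by (metis of_nat_eq_iff of_nat_power)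
    moreover have "coprime (v ^ p) (w ^ q)"
      using assms(3) by simp
    ultimately show False
      using v that by simp
  qed
  moreover have "ln v > 0" "ln w > 0" "- ln (1 - \<delta>) > 0"
    using v w \<delta> by auto
  ultimately obtain R where R: "\<And>z. z \<ge> R \<Longrightarrow>
      \<exists>(i::nat) (j::nat). i * ln v + j * ln w \<le> z \<and> z < i * ln v + j * ln w + - ln (1 - \<delta>)"
    using linear_combinations_eventually_dense[of "ln v" "ln w" "- ln (1 - \<delta>)"] by metis
  have "\<exists>i j. v ^ i * w ^ j \<le> n \<and> (1 - \<delta>) * real n < real (v ^ i * w ^ j)"
    if n: "n \<ge> nat \<lceil>exp R\<rceil>" for n
  proof -
    have "exp R \<le> n"
      using n by linarith
    then have n0: "real n > 0"
      using exp_gt_zero[of R] by linarith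
    then have "R \<le> ln n"
      using \<open>exp R \<le> n\<close> by (simp add: ln_ge_iff)
    then obtain i j :: nat where ij: "i * ln v + j * ln w \<le> ln n"
      "ln n < i * ln v + j * ln w + - ln (1 - \<delta>)"
      using R by blast
    have e: "i * ln v + j * ln w = ln (real (v ^ i * w ^ j))"
      using v w by (simp add: ln_mult ln_realpow)
    have pos: "real (v ^ i * w ^ j) > 0"
      using v w by simp
    have "ln ((1 - \<delta>) * real n) = ln (1 - \<delta>) + ln n"
      using \<delta> n0 by (simp add: ln_mult)
    then have "ln ((1 - \<delta>) * real n) < ln (real (v ^ i * w ^ j))"
      using ij(2) e by linarith
    then have "(1 - \<delta>) * real n < real (v ^ i * w ^ j)"
      using \<delta> n0 pos by (subst (asm) ln_less_cancel_iff) auto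
    moreover have "real (v ^ i * w ^ j) \<le> real n"
      using ij(1) e n0 pos by simp
    then have "v ^ i * w ^ j \<le> n"
      by linarith
    ultimately show ?thesis
      by blast
  qed
  then show ?thesis
    by blast
qed

section \<open>Packings at all scales\<close>

lemma max_covered_le: "max_covered t U \<le> U"
proof -
  have "card (\<Union>i\<in>{1..b}. pos_diffs (A i)) \<le> U" if "ruler_packing t U b A" for b A
  proof -
    have "(\<Union>i\<in>{1..b}. pos_diffs (A i)) \<subseteq> {1..int U}"
      using that unfolding ruler_packing_def by blast
    then have "card (\<Union>i\<in>{1..b}. pos_diffs (A i)) \<le> card {1..int U}"
      by (intro card_mono) auto
    then show ?thesis by simp
  qed
  then show ?thesis
    unfolding max_covered_def using max_covered_well_defined[of t U] by (subst Max_le_iff) blast+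
qed

lemma max_covered_mono:
  assumes "U \<le> U'"
  shows "max_covered t U \<le> max_covered t U'"
proof -
  have "ruler_packing t U' b A" if "ruler_packing t U b A" for b A
    using that assms unfolding ruler_packing_def by force
  then show ?thesis
    unfolding max_covered_def using max_covered_well_defined
    by (intro Max_mono) blast+
qed

lemma diff_family_trivial: "diff_family t 1 {}" "diffs t {} = {0}"
  by (auto simp: diff_family_def diffs_def)

text \<open>The product differences are the balanced base-\<open>v\<close> expansions with digits in
  \<open>[-W, W]\<close>, and these again fill a symmetric interval.\<close>

lemma interval_diff_family_power:
  assumes S: "two_transitive t S" and F: "diff_family t v F" "diffs t F = {- int W..int W}"
    and v: "v = 2 * W + 1"
  shows "\<exists>U H. v ^ k = 2 * U + 1 \<and> diff_family t (v ^ k) H \<and> diffs t H = {- int U..int U}"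
proof (induction k)
  case 0
  then show ?case
    using diff_family_trivial by (intro exI[of _ 0] exI[of _ "{}"]) auto
next
  case (Suc k)
  then obtain U H where H: "v ^ k = 2 * U + 1" "diff_family t (v ^ k) H" "diffs t H = {- int U..int U}"
    by blast
  obtain H' where H': "diff_family t (v ^ k * v) H'"
    "diffs t H' = {int v * x + y | x y. x \<in> diffs t H \<and> y \<in> diffs t F}"
    using diff_family_product[OF H(2) F(1) S] by blast
  have "diffs t H' = {- int (v * U + W)..int (v * U + W)}"
  proof (intro equalityI subsetI)
    fix z assume "z \<in> diffs t H'"
    then obtain x y where xy: "z = int v * x + y" "- int U \<le> x" "x \<le> int U" "- int W \<le> y" "y \<le> int W"
      unfolding H' H F by auto
    have "int v * x \<le> int v * int U" "int v * (- int U) \<le> int v * x"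
      using mult_left_mono[OF xy(3), of "int v"] mult_left_mono[OF xy(2), of "int v"] by simp_all
    then show "z \<in> {- int (v * U + W)..int (v * U + W)}"
      using xy by simp
  next
    fix z assume z: "z \<in> {- int (v * U + W)..int (v * U + W)}"
    \<comment> \<open>Shifting by \<open>W\<close> turns ordinary division with remainder into
      division with balanced remainder.\<close>
    define x y where "x = (z + int W) div int v" and "y = (z + int W) mod int v - int W"
    have e: "z = int v * x + y"
      unfolding x_def y_def using mult_div_mod_eq[of "int v" "z + int W"] by linarith
    have v': "int v = 2 * int W + 1" "0 < int v"
      using v by simp_all
    then have y: "- int W \<le> y" "y \<le> int W"
      unfolding y_def using pos_mod_sign[of "int v" "z + int W"] pos_mod_bound[of "int v" "z + int W"]
      by linarith+
    have "- (int v * int U + int W) \<le> z" "z \<le> int v * int U + int W"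
      using z by simp_all
    then have "int v * x < int v * int U + int v" "- (int v * int U) - int v < int v * x"
      using e y v'(1) by linarith+
    then have "int v * x < int v * (int U + 1)" "int v * (- int U - 1) < int v * x"
      by (simp_all only: distrib_left right_diff_distrib mult_minus_right mult_1_right)
    then have "x < int U + 1" "- int U - 1 < x"
      using v'(2) by (blast dest: mult_less_cancel_left_pos[THEN iffD1])+
    then show "z \<in> diffs t H'"
      unfolding H' H F using e y by (intro CollectI exI[of _ x] exI[of _ y]) auto
  qed
  moreover have "v ^ k * v = 2 * (v * U) + v"
    unfolding H(1) by (simp add: algebra_simps)
  then have "v ^ k * v = 2 * (v * U) + (2 * W + 1)"
    unfolding v[symmetric] .
  then have "v ^ k * v = 2 * (v * U + W) + 1"
    by simp
  ultimately have "v ^ Suc k = 2 * (v * U + W) + 1 \<and> diff_family t (v ^ Suc k) H' \<and>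
    diffs t H' = {- int (v * U + W)..int (v * U + W)}"
    unfolding power_Suc2 using H'(1) by (intro conjI)
  then show ?case
    by (rule_tac exI[of _ "v * U + W"], rule_tac exI[of _ H'])
qed

text \<open>The bound keeps each difference within one modulus of 0, so that multiplying an interval
  family by such a family only blurs the ends of the interval.\<close>

definition admissible :: "nat \<Rightarrow> nat \<Rightarrow> bool" where
  "admissible t m \<longleftrightarrow> (\<exists>G. diff_family t m G \<and> (\<forall>d\<in>diffs t G. \<bar>d\<bar> < int m))"

lemma admissible_1: "admissible t 1"
  unfolding admissible_def using diff_family_trivial by (intro exI[of _ "{}"]) auto

lemma admissible_mult:
  assumes "two_transitive t S" "admissible t m" "admissible t n"
  shows "admissible t (m * n)"
proof -
  obtain F G where FG: "diff_family t m F" "\<And>d. d \<in> diffs t F \<Longrightarrow> \<bar>d\<bar> < int m"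
    "diff_family t n G" "\<And>d. d \<in> diffs t G \<Longrightarrow> \<bar>d\<bar> < int n"
    using assms unfolding admissible_def by blast
  obtain H where H: "diff_family t (m * n) H"
    "diffs t H = {int n * x + y | x y. x \<in> diffs t F \<and> y \<in> diffs t G}"
    using diff_family_product[OF FG(1,3) assms(1)] by blast
  have "\<bar>int n * x + y\<bar> < int (m * n)" if "x \<in> diffs t F" "y \<in> diffs t G" for x y
  proof -
    have "\<bar>int n * x + y\<bar> \<le> int n * \<bar>x\<bar> + \<bar>y\<bar>"
      by (metis abs_mult abs_of_nat abs_triangle_ineq)
    also have "\<dots> < int n * \<bar>x\<bar> + int n"
      using FG(4)[OF that(2)] by simp
    also have "\<dots> = int n * (\<bar>x\<bar> + 1)"
      by (simp add: algebra_simps)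
    also have "\<dots> \<le> int n * int m"
      using FG(2)[OF that(1)] by (intro mult_left_mono) auto
    finally show ?thesis
      by (simp add: mult.commute)
  qed
  then have "\<forall>d\<in>diffs t H. \<bar>d\<bar> < int (m * n)"
    unfolding H(2) by blast
  then show ?thesis
    unfolding admissible_def using H(1) by blast
qed

lemma admissible_power:
  assumes "two_transitive t S" "admissible t m"
  shows "admissible t (m ^ k)"
proof (induction k)
  case (Suc k)
  then show ?case
    using admissible_mult[OF assms(1,2) Suc] by simp
qed (use admissible_1 in simp)

text \<open>The products \<open>n * x + y\<close> with \<open>\<bar>x\<bar> \<le> U\<close> and
  \<open>\<bar>y\<bar> < n\<close> do not exceed \<open>(U + 1) * n\<close>. Conversely, a positive
  \<open>z\<close> up to \<open>(U - 1) * n\<close> is congruent to some \<open>y\<close>, and then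
  the quotient \<open>x\<close> cannot leave \<open>[-U, U]\<close>.\<close>

lemma interval_inflation:
  assumes S: "two_transitive t S" and F: "diff_family t m F" "diffs t F = {- int U..int U}"
    and n: "admissible t n"
  shows "(U - 1) * n \<le> max_covered t ((U + 1) * n)"
proof -
  obtain G where G: "diff_family t n G" "\<And>d. d \<in> diffs t G \<Longrightarrow> \<bar>d\<bar> < int n"
    using n unfolding admissible_def by blast
  then have n0: "n > 0"
    by (auto simp: diff_family_def)
  obtain H where H: "diff_family t (m * n) H"
    "diffs t H = {int n * x + y | x y. x \<in> diffs t F \<and> y \<in> diffs t G}"
    using diff_family_product[OF F(1) G(1) S] by blast
  have "diffs t H \<subseteq> {- int ((U + 1) * n)..int ((U + 1) * n)}"
  proof
    fix z assume "z \<in> diffs t H"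
    then obtain x y where xy: "z = int n * x + y" "- int U \<le> x" "x \<le> int U" "y \<in> diffs t G"
      unfolding H F by auto
    have "int n * x \<le> int n * int U" "int n * (- int U) \<le> int n * x"
      using mult_left_mono[OF xy(3), of "int n"] mult_left_mono[OF xy(2), of "int n"] by simp_all
    moreover have "int ((U + 1) * n) = int n * int U + int n"
      by (simp add: algebra_simps)
    ultimately show "z \<in> {- int ((U + 1) * n)..int ((U + 1) * n)}"
      unfolding xy(1) atLeastAtMost_iff using G(2)[OF xy(4)] by linarith
  qed
  from diff_family_packing[OF H(1) this]
  have le: "card (diffs t H \<inter> {1..}) \<le> max_covered t ((U + 1) * n)" .
  have fin: "finite (diffs t H \<inter> {1..})"
    using \<open>diffs t H \<subseteq> _\<close> by (meson finite_Int finite_atLeastAtMost_int finite_subset)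
  have "{1..int ((U - 1) * n)} \<subseteq> diffs t H \<inter> {1..}"
  proof
    fix z assume z: "z \<in> {1..int ((U - 1) * n)}"
    \<comment> \<open>For \<open>U = 0\<close> the truncated subtraction gives an empty interval, so
      nothing has to be covered.\<close>
    then have "U \<noteq> 0"
      by (cases U) auto
    then have U: "int ((U - 1) * n) = int n * int U - int n"
      by (simp add: algebra_simps of_nat_diff)
    obtain y x where y: "y \<in> diffs t G" "z - y = int n * x"
      using G(1) unfolding diff_family_def dvd_def by blast
    have "int n * (- 1) < int n * x" "int n * x < int n * int U"
      using z y(2) G(2)[OF y(1)] unfolding U atLeastAtMost_iff by linarith+
    then have "- 1 < x" "x < int U"
      using n0 by (simp_all only: mult_less_cancel_left_pos of_nat_0_less_iff)
    then have "z \<in> diffs t H"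
      unfolding H F using y by (intro CollectI exI[of _ x] exI[of _ y]) auto
    then show "z \<in> diffs t H \<inter> {1..}"
      using z by auto
  qed
  then have "card {1..int ((U - 1) * n)} \<le> card (diffs t H \<inter> {1..})"
    using fin by (intro card_mono)
  then show ?thesis
    using le by (simp only: card_atLeastAtMost_int add_diff_cancel_right' diff_add_cancel nat_int)
qed

text \<open>A fixed large interval family is inflated by a variable number
  \<open>m = v ^ i * w ^ j\<close> chosen so that \<open>(U + 1) * m\<close> lies just below
  \<open>n\<close>. Two coprime moduli are needed because the powers of one alone have gaps of
  constant ratio.\<close>

lemma limit_one:
  assumes S: "two_transitive t S"
    and F: "diff_family t v F" "diffs t F = {- int W..int W}" and v: "v = 2 * W + 1" "v > 1"
    and w: "admissible t w" "w > 1" "coprime v w"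
  shows "(\<lambda>U. real (max_covered t U) / real U) \<longlonglongrightarrow> 1"
proof (rule LIMSEQ_I)
  fix r :: real assume "r > 0"
  define \<delta> where "\<delta> = min (r / 4) (1 / 2)"
  have \<delta>: "0 < \<delta>" "\<delta> < 1" "3 * \<delta> < r"
    using \<open>r > 0\<close> by (auto simp: \<delta>_def min_def)
  obtain k where k: "real v ^ k > 4 / \<delta> + 1"
    using real_arch_pow[of "real v"] v by auto
  obtain U H where U: "v ^ k = 2 * U + 1" and H: "diff_family t (v ^ k) H" "diffs t H = {- int U..int U}"
    using interval_diff_family_power[OF S F v(1)] by blast
  have "real v ^ k = 2 * real U + 1"
    using U by (metis of_nat_1 of_nat_add of_nat_mult of_nat_numeral of_nat_power)
  then have Ud: "real U > 2 / \<delta>"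
    using k by (simp add: field_simps)
  then have U0: "real U > 0"
    using \<delta> by (smt (verit) divide_nonneg_nonneg)
  have U1: "real (U - 1) \<ge> (1 - \<delta>) * real (U + 1)"
  proof -
    have "real U * \<delta> > 2"
      using Ud \<delta> by (simp add: field_simps)
    then show ?thesis
      using U0 \<delta> by (simp add: algebra_simps of_nat_diff)
  qed
  have adm: "admissible t v"
    unfolding admissible_def using F v by (intro exI[of _ F]) auto
  obtain R where R: "\<And>n. n \<ge> R \<Longrightarrow> \<exists>i j. v ^ i * w ^ j \<le> n \<and> (1 - \<delta>) * real n < real (v ^ i * w ^ j)"
    using coprime_powers_eventually_dense[OF v(2) w(2,3) \<delta>(1,2)] by blast
  obtain N :: nat where N: "real N > real (U + 1) / \<delta>"
    using reals_Archimedean2 by blast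
  show "\<exists>no. \<forall>n\<ge>no. norm (real (max_covered t n) / real n - 1) < r"
  proof (intro exI[of _ "max N (R * (U + 1))"] allI impI)
    fix n assume n: "max N (R * (U + 1)) \<le> n"
    define q where "q = n div (U + 1)"
    have "real (U + 1) / \<delta> < real n"
      using N n by linarith
    then have nd: "real (U + 1) < \<delta> * real n"
      using \<delta> by (simp add: field_simps)
    then have n0: "real n > 0"
      using \<delta> by (smt (verit) of_nat_0_le_iff mult_nonneg_nonpos)
    have "q \<ge> R"
      unfolding q_def using n by (simp add: less_eq_div_iff_mult_less_eq)
    then obtain i j where ij: "v ^ i * w ^ j \<le> q" "(1 - \<delta>) * real q < real (v ^ i * w ^ j)"
      using R by blast
    define m where "m = v ^ i * w ^ j"
    have am: "admissible t m"
      unfolding m_def by (intro admissible_mult[OF S] admissible_power[OF S] adm w)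
    have "(U + 1) * m \<le> (U + 1) * q"
      unfolding m_def using ij(1) by (rule mult_le_mono2)
    also have "\<dots> \<le> n"
      unfolding q_def by (rule times_div_less_eq_dividend)
    finally have mn: "(U + 1) * m \<le> n" .
    have "n < (U + 1) * q + (U + 1)"
      using dividend_less_div_times[of "U + 1" n] unfolding q_def
      by (simp only: add.commute mult.commute add_pos_pos)
    then have "real n < real ((U + 1) * q + (U + 1))"
      by (simp only: of_nat_less_iff)
    then have qn: "(1 - \<delta>) * real n \<le> real (U + 1) * real q"
      using nd by (simp add: algebra_simps)
    \<comment> \<open>Three losses of a factor \<open>1 - \<delta>\<close> each: rounding
      \<open>n\<close> to a multiple of \<open>U + 1\<close>, replacing \<open>q\<close> by
      \<open>m\<close>, and the blurred ends, which cost the ratio of \<open>U - 1\<close> to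
      \<open>U + 1\<close>.\<close>
    have "(1 - 3 * \<delta>) * real n \<le> (1 - \<delta>) * ((1 - \<delta>) * ((1 - \<delta>) * real n))"
    proof -
      have "(1 - \<delta>) * ((1 - \<delta>) * (1 - \<delta>)) - (1 - 3 * \<delta>) = \<delta> ^ 2 * (3 - \<delta>)"
        by (simp add: algebra_simps power2_eq_square)
      also have "\<dots> \<ge> 0"
        using \<delta> by simp
      finally have "(1 - 3 * \<delta>) \<le> (1 - \<delta>) * ((1 - \<delta>) * (1 - \<delta>))"
        by simp
      from mult_right_mono[OF this, of "real n"] show ?thesis
        by (simp add: mult.assoc)
    qed
    also have "\<dots> \<le> (1 - \<delta>) * ((1 - \<delta>) * (real (U + 1) * real q))"
      using qn \<delta> by (intro mult_left_mono) auto
    also have "\<dots> = ((1 - \<delta>) * real (U + 1)) * ((1 - \<delta>) * real q)"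
      by (simp add: algebra_simps)
    also have "\<dots> \<le> real (U - 1) * real m"
      using U1 ij \<delta> unfolding m_def by (intro mult_mono) auto
    also have "\<dots> \<le> real (max_covered t ((U + 1) * m))"
      using interval_inflation[OF S H am] by (metis of_nat_le_iff of_nat_mult)
    also have "\<dots> \<le> real (max_covered t n)"
      using max_covered_mono[OF mn] by simp
    finally have "1 - 3 * \<delta> \<le> real (max_covered t n) / real n"
      using n0 by (simp add: field_simps)
    moreover have "real (max_covered t n) / real n \<le> 1"
      using max_covered_le[of t n] n0 by simp
    ultimately show "norm (real (max_covered t n) / real n - 1) < r"
      using \<delta>(3) by simp
  qed
qed

section \<open>Explicit families and permutation groups checked by evaluation\<close>

definition list_functions :: "'a list list \<Rightarrow> (nat \<Rightarrow> 'a) set" where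
  "list_functions ls = (\<lambda>l i. l ! i) ` set ls"

lemma card_list_functions: "finite (list_functions ls)" "card (list_functions ls) \<le> length ls"
  unfolding list_functions_def by (auto intro: order.trans[OF card_image_le card_length])

definition list_diffs :: "int list list \<Rightarrow> int list" where
  "list_diffs ls = 0 # [y - x. l \<leftarrow> ls, x \<leftarrow> l, y \<leftarrow> l]"

lemma diffs_list_functions:
  assumes "\<forall>l\<in>set ls. length l = t"
  shows "diffs t (list_functions ls) = set (list_diffs ls)"
proof -
  have "{l ! j - l ! i | i j. i < t \<and> j < t} = {y - x | x y. x \<in> set l \<and> y \<in> set l}" if "l \<in> set ls" for l
    using assms that by (metis (no_types, opaque_lifting) in_set_conv_nth)
  then show ?thesis
    unfolding diffs_def list_functions_def list_diffs_def by fastforce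
qed

lemma diff_family_list_functions:
  assumes "\<forall>l\<in>set ls. length l = t" "length ls * (t * (t - 1)) < m"
    and "\<forall>x\<in>set [0..int m - 1]. \<exists>d\<in>set (list_diffs ls). (x - d) mod int m = 0"
  shows "diff_family t m (list_functions ls)"
  unfolding diff_family_def
proof (intro conjI allI)
  show "card (list_functions ls) * (t * (t - 1)) < m"
    using card_list_functions(2)[of ls] assms(2) by (meson le_less_trans mult_le_mono1)
  fix x :: int
  have "x mod int m \<in> set [0..int m - 1]"
    using assms(2) by simp
  from bspec[OF assms(3) this]
  obtain d where "d \<in> diffs t (list_functions ls)" "(x mod int m - d) mod int m = 0"
    unfolding diffs_list_functions[OF assms(1)] by (rule bexE)
  then show "\<exists>d\<in>diffs t (list_functions ls). int m dvd x - d"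
    by (intro bexI[of _ d]) (simp_all add: mod_diff_left_eq mod_eq_0_iff_dvd[symmetric])
qed (rule card_list_functions)

text \<open>Differences come in pairs \<open>d\<close>, \<open>- d\<close>, so only positive values
  need checking; \<open>2 * W + 1\<close> consecutive integers automatically form a complete residue
  system.\<close>

lemma interval_diff_family_list_functions:
  assumes "\<forall>l\<in>set ls. length l = t" "length ls * (t * (t - 1)) \<le> 2 * W"
    and bound: "\<forall>d\<in>set (list_diffs ls). \<bar>d\<bar> \<le> int W"
    and cover: "\<forall>x\<in>set [1..int W]. x \<in> set (list_diffs ls)"
  shows "diff_family t (2 * W + 1) (list_functions ls)" "diffs t (list_functions ls) = {- int W..int W}"
proof -
  let ?D = "diffs t (list_functions ls)"
  have neg: "- d \<in> ?D" if "d \<in> ?D" for d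
    using that unfolding diffs_def by force
  have pos: "x \<in> ?D" if "1 \<le> x" "x \<le> int W" for x
    using cover that unfolding diffs_list_functions[OF assms(1)] by auto
  have "x \<in> ?D" if "- int W \<le> x" "x \<le> int W" for x
    using pos[of x] neg[OF pos[of "- x"]] zero_in_diffs[of t "list_functions ls"] that
    by (cases x "0 :: int" rule: linorder_cases) auto
  moreover have "?D \<subseteq> {- int W..int W}"
    using bound unfolding diffs_list_functions[OF assms(1)] by fastforce
  ultimately show D: "?D = {- int W..int W}"
    by auto
  show "diff_family t (2 * W + 1) (list_functions ls)"
    unfolding diff_family_def
  proof (intro conjI allI)
    show "card (list_functions ls) * (t * (t - 1)) < 2 * W + 1"
      using card_list_functions(2)[of ls] assms(2)
      by (meson le_less_trans mult_le_mono1 less_add_one)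
    fix x :: int
    let ?v = "int (2 * W + 1)"
    have "(x + int W) mod ?v - int W \<in> ?D"
      unfolding D atLeastAtMost_iff using pos_mod_bound[of ?v "x + int W"] pos_mod_sign[of ?v "x + int W"]
      by linarith
    moreover have "?v dvd x - ((x + int W) mod ?v - int W)"
      using dvd_minus_mod[of ?v "x + int W"] by (simp add: algebra_simps)
    ultimately show "\<exists>d\<in>?D. ?v dvd x - d"
      by blast
  qed (rule card_list_functions)
qed

lemma two_transitive_list_functions:
  assumes "length ls \<le> t * (t - 1)" "\<forall>l\<in>set ls. length l = t \<and> (\<forall>x\<in>set l. x < t)"
    and "\<forall>i\<in>set [0..<t]. \<forall>j\<in>set [0..<t]. \<forall>k\<in>set [0..<t]. \<forall>l\<in>set [0..<t].
      i \<noteq> j \<longrightarrow> k \<noteq> l \<longrightarrow> (\<exists>s\<in>set ls. s ! i = k \<and> s ! j = l)"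
  shows "two_transitive t (list_functions ls)"
  unfolding two_transitive_def
proof (intro conjI)
  show "card (list_functions ls) \<le> t * (t - 1)"
    using card_list_functions(2)[of ls] assms(1) by linarith
  show "\<forall>\<sigma>\<in>list_functions ls. \<forall>i<t. \<sigma> i < t"
    using assms(2) by (auto simp: list_functions_def)
  show "\<forall>i<t. \<forall>j<t. \<forall>k<t. \<forall>l<t. i \<noteq> j \<longrightarrow> k \<noteq> l \<longrightarrow> (\<exists>\<sigma>\<in>list_functions ls. \<sigma> i = k \<and> \<sigma> j = l)"
    using assms(3) unfolding list_functions_def by simp
qed (rule card_list_functions)

lemma admissible_list_functions:
  assumes "\<forall>l\<in>set ls. length l = t" "length ls * (t * (t - 1)) < m"
    and "\<forall>x\<in>set [0..int m - 1]. \<exists>d\<in>set (list_diffs ls). (x - d) mod int m = 0"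
    and "\<forall>d\<in>set (list_diffs ls). \<bar>d\<bar> < int m"
  shows "admissible t m"
  unfolding admissible_def
  using diff_family_list_functions[OF assms(1-3)] assms(4)[folded diffs_list_functions[OF assms(1)]]
  by (intro exI[of _ "list_functions ls"] conjI)

section \<open>Three, four and five marks\<close>

text \<open>The affine maps \<open>a * x + b\<close> with \<open>a\<close> nonzero over the field
  with three elements.\<close>

lemma two_transitive_3:
  "two_transitive 3 (list_functions [[(a * x + b) mod 3. x \<leftarrow> [0..<3]]. a \<leftarrow> [1..<3], b \<leftarrow> [0..<3]])"
  by (rule two_transitive_list_functions; code_simp)

text \<open>The alternating group on four letters, which is the affine group of the field with four
  elements; it is tabulated because arithmetic mod 4 is not that of a field.\<close>

lemma two_transitive_4:
  "two_transitive 4 (list_functions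
    [[0, 1, 2, 3], [0, 2, 3, 1], [0, 3, 1, 2], [1, 0, 3, 2], [1, 2, 0, 3], [1, 3, 2, 0],
     [2, 0, 1, 3], [2, 1, 3, 0], [2, 3, 0, 1], [3, 0, 2, 1], [3, 1, 0, 2], [3, 2, 1, 0]])"
  by (rule two_transitive_list_functions; code_simp)

lemma two_transitive_5:
  "two_transitive 5 (list_functions [[(a * x + b) mod 5. x \<leftarrow> [0..<5]]. a \<leftarrow> [1..<5], b \<leftarrow> [0..<5]])"
  by (rule two_transitive_list_functions; code_simp)

lemma limit_3: "(\<lambda>U. real (max_covered 3 U) / real U) \<longlonglongrightarrow> 1"
proof -
  \<comment> \<open>A perfect ruler: its differences are 1, 2, 3. The moduli are 7 and 13.\<close>
  let ?F = "[[0, 1, 3]]"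
  have F: "diff_family 3 (2 * 3 + 1) (list_functions ?F)" "diffs 3 (list_functions ?F) = {- int 3..int 3}"
    by (rule interval_diff_family_list_functions; code_simp)+
  have w: "admissible 3 13"
    by (rule admissible_list_functions[of "[[0, 1, 4], [0, 2, 7]]"]; code_simp)
  show ?thesis
    by (rule limit_one[OF two_transitive_3 F refl _ w]) (simp_all add: coprime_iff_gcd_eq_1 gcd_non_0_nat)
qed

lemma limit_4: "(\<lambda>U. real (max_covered 4 U) / real U) \<longlonglongrightarrow> 1"
proof -
  \<comment> \<open>Again a perfect ruler, with differences 1 to 6. The moduli are 13 and
    37.\<close>
  let ?F = "[[0, 1, 4, 6]]"
  have F: "diff_family 4 (2 * 6 + 1) (list_functions ?F)" "diffs 4 (list_functions ?F) = {- int 6..int 6}"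
    by (rule interval_diff_family_list_functions; code_simp)+
  have w: "admissible 4 37"
    by (rule admissible_list_functions[of "[[0, 1, 3, 24], [0, 4, 9, 15], [0, 7, 17, 25]]"]; code_simp)
  show ?thesis
    by (rule limit_one[OF two_transitive_4 F refl _ w]) (simp_all add: coprime_iff_gcd_eq_1 gcd_non_0_nat)
qed

lemma limit_5: "(\<lambda>U. real (max_covered 5 U) / real U) \<longlonglongrightarrow> 1"
proof -
  \<comment> \<open>No single five-mark ruler has differences 1 to 10, but these six together have
    exactly the differences 1 to 60.\<close>
  let ?F = "[[0, 2, 33, 50, 60], [0, 5, 28, 39, 57], [0, 3, 24, 44, 59],
    [0, 1, 14, 46, 54], [0, 4, 26, 42, 51], [0, 6, 36, 43, 55]]"
  have F: "diff_family 5 (2 * 60 + 1) (list_functions ?F)" "diffs 5 (list_functions ?F) = {- int 60..int 60}"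
    by (rule interval_diff_family_list_functions; code_simp)+
  have w: "admissible 5 21"
    \<comment> \<open>The perfect difference set of the projective plane of order 4; its modulus 21
      is coprime to 121.\<close>
    by (rule admissible_list_functions[of "[[0, 1, 4, 14, 16]]"]; code_simp)
  show ?thesis
    by (rule limit_one[OF two_transitive_5 F refl _ w]) (simp_all add: coprime_iff_gcd_eq_1 gcd_non_0_nat)
qed

section \<open>Six or more marks\<close>

text \<open>Enumerating the marks in increasing order turns sums over differences into sums over
  index pairs; the Golomb property makes this reindexing injective.\<close>

lemma golomb_ruler_marks:
  assumes "golomb_ruler t A"
  obtains m :: "nat \<Rightarrow> int" where "\<And>i j. i < j \<Longrightarrow> j < t \<Longrightarrow> m i < m j"
    "\<And>i j. i < j \<Longrightarrow> j < t \<Longrightarrow> m j - m i \<in> pos_diffs A"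
    "\<And>f :: int \<Rightarrow> int. sum f (pos_diffs A) = (\<Sum>(i, j)\<in>{(i, j). i < j \<and> j < t}. f (m j - m i))"
proof -
  have A: "finite A" "card A = t"
    and inj: "inj_on (\<lambda>(x, y). y - x) {(x, y). x \<in> A \<and> y \<in> A \<and> x < y}"
    using assms by (auto simp: golomb_ruler_def)
  define m where "m = (\<lambda>i. sorted_list_of_set A ! i)"
  have len: "length (sorted_list_of_set A) = t"
    using A by simp
  have mA: "m i \<in> A" if "i < t" for i
    unfolding m_def using A len that by (metis nth_mem set_sorted_list_of_set)
  have mono: "m i < m j" if "i < j" "j < t" for i j
    unfolding m_def using len that
    by (intro sorted_wrt_nth_less[OF strict_sorted_list_of_set]) auto
  have surj: "\<exists>i<t. m i = x" if "x \<in> A" for x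
  proof -
    have "x \<in> set (sorted_list_of_set A)"
      using A that by simp
    then show ?thesis
      unfolding in_set_conv_nth len m_def by blast
  qed
  let ?P = "{(i, j). i < j \<and> j < t}"
  let ?d = "\<lambda>(i, j). m j - m i"
  have inj': "inj_on ?d ?P"
  proof (rule inj_onI)
    fix p q assume p: "p \<in> ?P" and q: "q \<in> ?P" and eq: "?d p = ?d q"
    obtain i j where ij: "p = (i, j)" "i < j" "j < t"
      using p by auto
    obtain i' j' where ij': "q = (i', j')" "i' < j'" "j' < t"
      using q by auto
    have "(m i, m j) = (m i', m j')"
    proof (rule inj_onD[OF inj])
      show "(\<lambda>(x, y). y - x) (m i, m j) = (\<lambda>(x, y). y - x) (m i', m j')"
        using eq unfolding ij(1) ij'(1) by simp
    qed (use ij(2,3) ij'(2,3) mA mono in auto)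
    then have "i = i'" "j = j'"
      using mono[of i i'] mono[of i' i] mono[of j j'] mono[of j' j] ij(2,3) ij'(2,3)
      by (cases i i' rule: linorder_cases; simp; fail | cases j j' rule: linorder_cases; simp)+
    then show "p = q"
      unfolding ij(1) ij'(1) by simp
  qed
  have "pos_diffs A = ?d ` ?P"
  proof (intro equalityI subsetI)
    fix z assume "z \<in> pos_diffs A"
    then obtain x y where xy: "z = y - x" "x \<in> A" "y \<in> A" "x < y"
      by (auto simp: pos_diffs_def)
    obtain i j where "i < t" "m i = x" "j < t" "m j = y"
      using surj[OF xy(2)] surj[OF xy(3)] by blast
    moreover from this have "i < j"
      using mono[of j i] xy(4) by (cases i j rule: linorder_cases) auto
    ultimately show "z \<in> ?d ` ?P"
      using xy(1) by (intro image_eqI[of _ _ "(i, j)"]) auto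
  next
    fix z assume "z \<in> ?d ` ?P"
    then obtain i j where "i < j" "j < t" "z = m j - m i"
      by auto
    then show "z \<in> pos_diffs A"
      unfolding pos_diffs_def using mA[of i] mA[of j] mono[of i j] by auto
  qed
  then have "sum f (pos_diffs A) = (\<Sum>(i, j)\<in>?P. f (m j - m i))" for f :: "int \<Rightarrow> int"
    using sum.reindex[OF inj', of f] by (simp add: case_prod_beta' comp_def)
  moreover have "m j - m i \<in> pos_diffs A" if "i < j" "j < t" for i j
    unfolding pos_diffs_def using mA[of i] mA[of j] mono[of i j] that by auto
  ultimately show thesis
    using mono by (intro that[of m])
qed

text \<open>Linear programming duality: split the sum of \<open>\<psi>\<close> over
  \<open>[1, U]\<close> into the rulers, each contributing at most \<open>- C\<close>, and the
  uncovered values, each contributing at most \<open>M\<close>. This bounds the number of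
  rulers.\<close>

lemma test_function_bound:
  fixes \<psi> :: "int \<Rightarrow> int"
  assumes pack: "ruler_packing t U b A"
    and ruler: "\<And>B. golomb_ruler t B \<Longrightarrow> pos_diffs B \<subseteq> {1..int U} \<Longrightarrow> sum \<psi> (pos_diffs B) \<le> - C"
    and M: "\<And>x. \<psi> x \<le> M"
  shows "card (\<Union>i\<in>{1..b}. pos_diffs (A i)) = b * (t choose 2)"
    and "int b * C \<le> - sum \<psi> {1..int U} + M * (int U - int (b * (t choose 2)))"
proof -
  let ?S = "\<Union>i\<in>{1..b}. pos_diffs (A i)"
  have A: "golomb_ruler t (A i)" "pos_diffs (A i) \<subseteq> {1..int U}" if "i \<in> {1..b}" for i
    using pack that unfolding ruler_packing_def by blast+
  have disj: "\<forall>i\<in>{1..b}. \<forall>j\<in>{1..b}. i \<noteq> j \<longrightarrow> pos_diffs (A i) \<inter> pos_diffs (A j) = {}"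
    using pack unfolding ruler_packing_def disjoint_family_on_def by blast
  have fin: "\<forall>i\<in>{1..b}. finite (pos_diffs (A i))"
    using A(2) by (meson finite_atLeastAtMost_int finite_subset)
  have S: "?S \<subseteq> {1..int U}"
    using A(2) by blast
  have "card ?S = (\<Sum>i\<in>{1..b}. card (pos_diffs (A i)))"
    using fin disj by (intro card_UN_disjoint) auto
  also have "\<dots> = (\<Sum>i\<in>{1..b}. t choose 2)"
    using A(1) by (intro sum.cong) (auto simp: golomb_ruler_iff_card)
  finally show c: "card ?S = b * (t choose 2)"
    by simp
  have "sum \<psi> ?S = (\<Sum>i\<in>{1..b}. sum \<psi> (pos_diffs (A i)))"
    using fin disj by (intro sum.UNION_disjoint) auto
  also have "\<dots> \<le> (\<Sum>i\<in>{1..b}. - C)"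
    using A ruler by (intro sum_mono) blast
  finally have 1: "sum \<psi> ?S \<le> - (int b * C)"
    by simp
  have fS: "finite ?S"
    using fin by blast
  have "sum \<psi> ({1..int U} - ?S) \<le> (\<Sum>x\<in>{1..int U} - ?S. M)"
    using M by (intro sum_mono)
  also have "\<dots> = M * int (card ({1..int U} - ?S))"
    by simp
  also have "card ({1..int U} - ?S) = card {1..int U} - card ?S"
    using fS S by (rule card_Diff_subset)
  also have "int (card {1..int U} - card ?S) = int U - int (card ?S)"
    using card_mono[OF _ S] by simp
  finally have 2: "sum \<psi> ({1..int U} - ?S) \<le> M * (int U - int (b * (t choose 2)))"
    unfolding c .
  have "sum \<psi> {1..int U} = sum \<psi> ({1..int U} - ?S) + sum \<psi> ?S"
    using S by (rule sum.subset_diff) simp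
  then show "int b * C \<le> - sum \<psi> {1..int U} + M * (int U - int (b * (t choose 2)))"
    using 1 2 by linarith
qed

text \<open>For \<open>p \<le> q\<close> this is minus the distance from \<open>x\<close> to the
  interval \<open>[p, q]\<close>.\<close>

definition clip :: "int \<Rightarrow> int \<Rightarrow> int \<Rightarrow> int" where
  "clip p q x = min (x - p) 0 - max (x - q) 0"

lemma clip_bounds: "p \<le> q \<Longrightarrow> clip p q x \<le> x - p" "p \<le> q \<Longrightarrow> clip p q x \<le> q - x" "clip p q x \<le> 0"
  by (auto simp: clip_def)

lemma atLeastAtMost_int_Suc: "{1..int (Suc n)} = insert (int (Suc n)) {1..int n}"
  by auto

lemma sum_clip:
  assumes "p \<le> n" "q \<le> n"
  shows "2 * sum (clip (int p) (int q)) {1..int n} =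
    - (int p * (int p - 1)) - (int n - int q) * (int n - int q + 1)"
proof -
  have gauss: "2 * (\<Sum>x\<in>{1..int k}. x) = int k * (int k + 1)" for k
    by (induction k) (simp, simp only: atLeastAtMost_int_Suc, simp add: algebra_simps)
  have "2 * (\<Sum>x\<in>{1..int n}. min (x - int p) 0) = - (int p * (int p - 1))"
    using assms(1)
  proof (induction n rule: dec_induct)
    case base
    have "(\<Sum>x\<in>{1..int p}. min (x - int p) 0) = (\<Sum>x\<in>{1..int p}. x - int p)"
      by (intro sum.cong) auto
    also have "\<dots> = (\<Sum>x\<in>{1..int p}. x) - int p * int p"
      by (simp add: sum_subtractf)
    finally show ?case
      using gauss[of p] by (simp add: algebra_simps)
  next
    case (step k)
    then show ?case
      unfolding atLeastAtMost_int_Suc by simp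
  qed
  moreover have "2 * (\<Sum>x\<in>{1..int n}. max (x - int q) 0) = (int n - int q) * (int n - int q + 1)"
    using assms(2)
  proof (induction n rule: dec_induct)
    case base
    show ?case
      by simp
  next
    case (step k)
    then show ?case
      unfolding atLeastAtMost_int_Suc by (simp add: algebra_simps)
  qed
  ultimately show ?thesis
    unfolding clip_def by (simp add: sum_subtractf algebra_simps)
qed

text \<open>Estimate \<open>clip\<close> by \<open>x - p\<close> on single and double gaps, by
  \<open>q - x\<close> on the three longest differences, and by 0 elsewhere. The gap sums telescope
  to the sum of the three longest differences, so the marks cancel and only the thresholds
  remain.\<close>

lemma sum_clip_pos_diffs:
  assumes t: "t \<ge> 6" and A: "golomb_ruler t A" and pq: "p \<le> q"
  shows "sum (clip p q) (pos_diffs A) \<le> - ((2 * int t - 3) * p - 3 * q)"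
proof -
  obtain m where m: "sum (clip p q) (pos_diffs A) = (\<Sum>(i, j)\<in>{(i, j). i < j \<and> j < t}. clip p q (m j - m i))"
    by (rule golomb_ruler_marks[OF A]) blast
  let ?P = "{(i, j). i < j \<and> j < t}"
  let ?f = "\<lambda>(i, j). clip p q (m j - m i)"
  \<comment> \<open>Single gaps, double gaps and the three longest differences; the assumption on
    \<open>t\<close> keeps these sets of pairs disjoint.\<close>
  define Q1 Q2 Q3 :: "(nat \<times> nat) set" where "Q1 = (\<lambda>i. (i, Suc i)) ` {..<t - 1}" and "Q2 = (\<lambda>i. (i, Suc (Suc i))) ` {..<t - 2}"
    and "Q3 = {(0, t - 1), (0, t - 2), (1, t - 1)}"
  have fin: "finite Q1" "finite Q2" "finite Q3"
    by (auto simp: Q1_def Q2_def Q3_def)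
  have sub: "Q1 \<union> Q2 \<union> Q3 \<subseteq> ?P"
    using t by (auto simp: Q1_def Q2_def Q3_def)
  have finP: "finite ?P"
    by (rule finite_subset[of _ "{..<t} \<times> {..<t}"]) auto
  have "Q1 \<inter> Q2 = {}" "(Q1 \<union> Q2) \<inter> Q3 = {}"
    using t by (auto simp: Q1_def Q2_def Q3_def)
  then have "sum ?f (Q1 \<union> Q2 \<union> Q3) = sum ?f Q1 + sum ?f Q2 + sum ?f Q3"
    using fin by (simp add: sum.union_disjoint)
  moreover have "sum ?f ?P = sum ?f (?P - (Q1 \<union> Q2 \<union> Q3)) + sum ?f (Q1 \<union> Q2 \<union> Q3)"
    using sub finP by (rule sum.subset_diff)
  moreover have "sum ?f (?P - (Q1 \<union> Q2 \<union> Q3)) \<le> 0"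
    by (intro sum_nonpos) (auto simp: clip_bounds)
  moreover have "sum ?f Q1 = (\<Sum>i<t - 1. clip p q (m (Suc i) - m i))"
    unfolding Q1_def by (subst sum.reindex) (auto simp: inj_on_def)
  moreover have "\<dots> \<le> (\<Sum>i<t - 1. (m (Suc i) - m i) - p)"
    using clip_bounds(1)[OF pq] by (intro sum_mono)
  moreover have "(\<Sum>i<t - 1. (m (Suc i) - m i) - p) = m (t - 1) - m 0 - (int t - 1) * p"
    using t by (simp only: sum_subtractf[of _ "\<lambda>_. p"] sum_lessThan_telescope) (simp add: of_nat_diff)
  moreover have "sum ?f Q2 = (\<Sum>i<t - 2. clip p q (m (Suc (Suc i)) - m i))"
    unfolding Q2_def by (subst sum.reindex) (auto simp: inj_on_def)
  moreover have "\<dots> \<le> (\<Sum>i<t - 2. (m (Suc (Suc i)) - m (Suc i)) + (m (Suc i) - m i) - p)"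
  proof (rule sum_mono)
    fix i
    show "clip p q (m (Suc (Suc i)) - m i) \<le> (m (Suc (Suc i)) - m (Suc i)) + (m (Suc i) - m i) - p"
      using clip_bounds(1)[OF pq, of "m (Suc (Suc i)) - m i"] by simp
  qed
  moreover have "(\<Sum>i<t - 2. (m (Suc (Suc i)) - m (Suc i)) + (m (Suc i) - m i) - p) =
      (m (t - 1) - m 1) + (m (t - 2) - m 0) - (int t - 2) * p"
  proof -
    have "Suc (t - 2) = t - 1"
      using t by simp
    then show ?thesis
      using t sum_lessThan_telescope[of "\<lambda>i. m (Suc i)" "t - 2"] sum_lessThan_telescope[of m "t - 2"]
      by (simp add: sum_subtractf sum.distrib of_nat_diff)
  qed
  moreover have "sum ?f Q3 = clip p q (m (t - 1) - m 0) + clip p q (m (t - 2) - m 0) + clip p q (m (t - 1) - m 1)"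
    unfolding Q3_def using t by simp
  moreover have "\<dots> \<le> (q - (m (t - 1) - m 0)) + (q - (m (t - 2) - m 0)) + (q - (m (t - 1) - m 1))"
    by (intro add_mono clip_bounds(2)[OF pq])
  ultimately have "sum ?f ?P \<le> - (int t - 1) * p - (int t - 2) * p + 3 * q"
    by linarith
  then show ?thesis
    unfolding m by (simp add: algebra_simps)
qed

lemma max_covered_attained:
  obtains b A where "ruler_packing t U b A" "max_covered t U = card (\<Union>i\<in>{1..b}. pos_diffs (A i))"
proof -
  have "max_covered t U \<in> {card (\<Union>i\<in>{1..b}. pos_diffs (A i)) | b A. ruler_packing t U b A}"
    unfolding max_covered_def by (rule Max_in[OF max_covered_well_defined])
  then show thesis
    using that by blast
qed

text \<open>Since \<open>clip\<close> is nowhere positive, uncovered values cost nothing and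
  \<open>M = 0\<close>. Comparing the ruler bound with the full sum over \<open>[1, N * V]\<close>
  leaves a covered proportion of at most \<open>X / (2 * X - 6 * N)\<close>.\<close>

lemma max_covered_ge_7:
  assumes t: "t \<ge> 7"
  defines "X \<equiv> (2 * real t - 3)\<^sup>2 + 9" and "N \<equiv> t choose 2"
  shows "(2 * X - 6 * N) * max_covered t (N * V) \<le> X * real (N * V)"
proof -
  obtain b A where pack: "ruler_packing t (N * V) b A"
    "max_covered t (N * V) = card (\<Union>i\<in>{1..b}. pos_diffs (A i))"
    using max_covered_attained by blast
  \<comment> \<open>Quantiles: a proportion \<open>(2 * t - 3) / N\<close> of the range lies below
    \<open>p\<close> and \<open>3 / N\<close> above \<open>q\<close>, matching the shares of short
    and long differences in each ruler.\<close>
  define p q where "p = (2 * t - 3) * V" and "q = (N - 3) * V"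
  have "2 * N = t * (t - 1)"
    unfolding N_def choose_two by (intro dvd_mult_div_cancel) auto
  then have N2: "2 * int N = int t * (int t - 1)"
    using t by (metis int_ops(2) of_nat_diff of_nat_mult of_nat_numeral order.trans one_le_numeral)
  have t7: "int t \<ge> 7"
    using t by simp
  then have "7 * (int t - 1) \<le> int t * (int t - 1)"
    by (intro mult_right_mono) auto
  then have "7 * (int t - 1) \<le> 2 * int N"
    unfolding N2 .
  then have N3: "int N \<ge> 3" "int N - 3 \<ge> 2 * int t - 3"
    using t7 by simp_all
  have p: "int p = (2 * int t - 3) * int V" and q: "int q = (int N - 3) * int V"
    using t N3 by (auto simp: p_def q_def of_nat_diff)
  have pq: "int p \<le> int q"
    unfolding p q using N3 by (intro mult_right_mono) auto
  have le: "p \<le> N * V" "q \<le> N * V"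
  proof -
    show "q \<le> N * V"
      unfolding q_def by simp
    with pq show "p \<le> N * V"
      by linarith
  qed
  have ruler: "sum (clip p q) (pos_diffs B) \<le> - ((2 * int t - 3) * int p - 3 * int q)"
    if "golomb_ruler t B" "pos_diffs B \<subseteq> {1..int (N * V)}" for B
    using sum_clip_pos_diffs[OF _ that(1) pq] t by simp
  note bound = test_function_bound[OF pack(1) ruler clip_bounds(3), folded N_def]
  have c: "card (\<Union>i\<in>{1..b}. pos_diffs (A i)) = b * N"
    and 1: "int b * ((2 * int t - 3) * int p - 3 * int q) \<le> - sum (clip p q) {1..int (N * V)}"
    using bound by simp_all
  have r: "int (N * V) - int q = 3 * int V"
    unfolding q by (simp add: algebra_simps)
  have "2 * (int b * ((2 * int t - 3) * int p - 3 * int q)) \<le> int p * (int p - 1) + 3 * int V * (3 * int V + 1)"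
    using 1 sum_clip[OF le] unfolding r by linarith
  also have "\<dots> = int p * int p + 9 * (int V * int V) + (3 * int V - int p)"
    by (simp add: algebra_simps)
  also have "3 * int V - int p \<le> 0"
    unfolding p using t mult_right_mono[of 3 "2 * int t - 3" "int V"] by simp
  finally have "2 * (int b * ((2 * int t - 3) * int p - 3 * int q)) \<le> int p * int p + 9 * (int V * int V)"
    by simp
  then have "(2 * int b * ((2 * int t - 3)\<^sup>2 - 3 * int N + 9)) * int V \<le> (((2 * int t - 3)\<^sup>2 + 9) * int V) * int V"
    unfolding p q by (simp add: algebra_simps power2_eq_square)
  then have "2 * int b * ((2 * int t - 3)\<^sup>2 - 3 * int N + 9) \<le> ((2 * int t - 3)\<^sup>2 + 9) * int V" if "V > 0"
    using that by (simp only: mult_le_cancel_right split: if_splits)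
  moreover have "b = 0" if "V = 0"
  proof -
    have "b * N = 0"
      using c pack(2) that max_covered_le[of t "N * V"] by simp
    then show ?thesis
      using N3 by simp
  qed
  ultimately have "2 * int b * ((2 * int t - 3)\<^sup>2 - 3 * int N + 9) \<le> ((2 * int t - 3)\<^sup>2 + 9) * int V"
    by (cases "V = 0") auto
  then have "real_of_int (2 * int b * ((2 * int t - 3)\<^sup>2 - 3 * int N + 9)) \<le> real_of_int (((2 * int t - 3)\<^sup>2 + 9) * int V)"
    by (simp only: of_int_le_iff)
  then have "(2 * X - 6 * N) * b \<le> X * V"
    unfolding X_def by (simp add: algebra_simps)
  then have "(2 * X - 6 * N) * b * N \<le> X * V * N"
    by (rule mult_right_mono) simp
  then show ?thesis
    unfolding pack(2) c by (simp add: algebra_simps)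
qed

section \<open>Six marks\<close>

text \<open>At the scale \<open>U = 500 * W\<close>, the weight function detecting the middle parts of \<open>[U/5, 2U/5]\<close> and
  \<open>[2U/5, 3U/5]\<close>. The margins of \<open>3 * W\<close> absorb rulers that miss equality in the sum bound
  by less than \<open>W\<close>; the others lose more there than the weights can gain.\<close>

definition plateau :: "int \<Rightarrow> int \<Rightarrow> int" where
  "plateau W x = (if 103 * W \<le> x \<and> x \<le> 197 * W then 1 else if 203 * W \<le> x \<and> x \<le> 297 * W then 3 else 0)"

lemma plateau_bounds:
  "plateau W x \<le> 3" "x < 103 * W \<Longrightarrow> 0 < W \<Longrightarrow> plateau W x = 0" "297 * W < x \<Longrightarrow> 0 < W \<Longrightarrow> plateau W x = 0"
  "x < 203 * W \<Longrightarrow> plateau W x \<le> 1"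
  by (auto simp: plateau_def)

lemma six_mark_inequality:
  fixes a b c d e W :: int
  defines "\<psi> \<equiv> \<lambda>x. 34 * clip (300 * W) (400 * W) x + W * plateau W x"
  assumes W: "W > 0" and gaps: "a > 0" "b > 0" "c > 0" "d > 0" "e > 0" "a + b + c + d + e \<le> 500 * W"
  shows "\<psi> a + \<psi> b + \<psi> c + \<psi> d + \<psi> e + \<psi> (a + b) + \<psi> (b + c) + \<psi> (c + d) + \<psi> (d + e)
    + \<psi> (a + b + c) + \<psi> (b + c + d) + \<psi> (c + d + e) + \<psi> (a + b + c + d) + \<psi> (b + c + d + e)
    + \<psi> (a + b + c + d + e) \<le> - 50989 * W"
proof -
  let ?\<phi> = "clip (300 * W) (400 * W)" and ?w = "plateau W"
  define \<Phi> where "\<Phi> = ?\<phi> a + ?\<phi> b + ?\<phi> c + ?\<phi> d + ?\<phi> e + ?\<phi> (a + b) + ?\<phi> (b + c) + ?\<phi> (c + d) + ?\<phi> (d + e)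
    + ?\<phi> (a + b + c) + ?\<phi> (b + c + d) + ?\<phi> (c + d + e) + ?\<phi> (a + b + c + d) + ?\<phi> (b + c + d + e)
    + ?\<phi> (a + b + c + d + e)"
  define \<Omega> where "\<Omega> = ?w a + ?w b + ?w c + ?w d + ?w e + ?w (a + b) + ?w (b + c) + ?w (c + d) + ?w (d + e)
    + ?w (a + b + c) + ?w (b + c + d) + ?w (c + d + e) + ?w (a + b + c + d) + ?w (b + c + d + e)
    + ?w (a + b + c + d + e)"
  have eq: "\<psi> a + \<psi> b + \<psi> c + \<psi> d + \<psi> e + \<psi> (a + b) + \<psi> (b + c) + \<psi> (c + d) + \<psi> (d + e)
    + \<psi> (a + b + c) + \<psi> (b + c + d) + \<psi> (c + d + e) + \<psi> (a + b + c + d) + \<psi> (b + c + d + e)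
    + \<psi> (a + b + c + d + e) = 34 * \<Phi> + W * \<Omega>"
    unfolding \<psi>_def \<Phi>_def \<Omega>_def by (simp only: distrib_left ac_simps)
  have lo: "?\<phi> x \<le> x - 300 * W" and hi: "?\<phi> x \<le> 400 * W - x" and np: "?\<phi> x \<le> 0" for x
    using clip_bounds[of "300 * W" "400 * W" x] W by auto
  note bot = lo[of a] lo[of b] lo[of c] lo[of d] lo[of e] lo[of "a + b"] lo[of "b + c"] lo[of "c + d"] lo[of "d + e"]
  note top = hi[of "a + b + c + d"] hi[of "b + c + d + e"] hi[of "a + b + c + d + e"]
  note mid = np[of "a + b + c"] np[of "b + c + d"] np[of "c + d + e"]
  note w3 = plateau_bounds(1)[of W]
  \<comment> \<open>Nine short differences give \<open>- 2700 * W\<close>, three long ones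
    \<open>1200 * W\<close>, and the gaps themselves cancel.\<close>
  have base: "\<Phi> \<le> - 1500 * W"
    unfolding \<Phi>_def using bot top mid by linarith
  show ?thesis
  \<comment> \<open>The factor 34 is \<open>45 - 11\<close>: losing a further \<open>W\<close> in
    \<open>\<Phi>\<close> pays for the trivial bound 45 on \<open>\<Omega>\<close>, while without
    that loss \<open>\<Omega> \<le> 11\<close>. Both cases end at
    \<open>- 50989 * W\<close>.\<close>
  proof (cases "\<Phi> \<le> - 1501 * W")
    case True
    have "\<Omega> \<le> 45"
      unfolding \<Omega>_def using w3[of a] w3[of b] w3[of c] w3[of d] w3[of e] w3[of "a + b"] w3[of "b + c"]
        w3[of "c + d"] w3[of "d + e"] w3[of "a + b + c"] w3[of "b + c + d"] w3[of "c + d + e"]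
        w3[of "a + b + c + d"] w3[of "b + c + d + e"] w3[of "a + b + c + d + e"] by linarith
    then have "W * \<Omega> \<le> W * 45"
      using W by (intro mult_left_mono) auto
    then show ?thesis
      unfolding eq using True by linarith
  next
    case False
    note tight = False[unfolded \<Phi>_def]
    \<comment> \<open>Using the wrong branch of \<open>clip\<close> for any one difference would
      lose at least \<open>W\<close>, so each difference stays on its side of the threshold up to a
      slack of \<open>W\<close>.\<close>
    have b: "a + b \<le> 301 * W" "b + c \<le> 301 * W" "c + d \<le> 301 * W" "d + e \<le> 301 * W"
      using tight bot top mid np[of "a + b"] np[of "b + c"] np[of "c + d"] np[of "d + e"] by linarith+
    have m: "a + b + c \<ge> 299 * W" "b + c + d \<ge> 299 * W" "c + d + e \<ge> 299 * W"
      using tight bot top mid lo[of "a + b + c"] lo[of "b + c + d"] lo[of "c + d + e"] by linarith+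
    have t: "a + b + c + d \<ge> 399 * W" "b + c + d + e \<ge> 399 * W"
      using tight bot top mid np[of "a + b + c + d"] np[of "b + c + d + e"] by linarith+
    have "?w a = 0" "?w e = 0"
      using t gaps W by (auto intro!: plateau_bounds(2))
    moreover have "?w (a + b + c) = 0" "?w (b + c + d) = 0" "?w (c + d + e) = 0"
      "?w (a + b + c + d) = 0" "?w (b + c + d + e) = 0" "?w (a + b + c + d + e) = 0"
      using m t gaps W by (auto intro!: plateau_bounds(3))
    moreover have "?w (a + b) \<le> 1" "?w (d + e) \<le> 1"
      using m gaps W by (auto intro!: plateau_bounds(4))
    \<comment> \<open>If \<open>c\<close> has weight 3, then \<open>b + c\<close> and
      \<open>c + d\<close>, being at most \<open>301 * W\<close>, leave \<open>b\<close> and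
      \<open>d\<close> below the first plateau. Otherwise each of the three weighs at most
      1.\<close>
    moreover have "?w b + ?w c + ?w d \<le> 3"
    proof (cases "c < 203 * W")
      case True
      moreover have "b < 203 * W" "d < 203 * W"
        using m gaps W by auto
      ultimately show ?thesis
        using plateau_bounds(4)[of b W] plateau_bounds(4)[of c W] plateau_bounds(4)[of d W] by linarith
    next
      case False
      then have "?w b = 0" "?w d = 0"
        using b W by (auto intro!: plateau_bounds(2))
      then show ?thesis
        using w3[of c] by simp
    qed
    ultimately have "\<Omega> \<le> 11"
      unfolding \<Omega>_def using w3[of "b + c"] w3[of "c + d"] by linarith
    then have "W * \<Omega> \<le> W * 11"
      using W by (intro mult_left_mono) auto
    then show ?thesis
      unfolding eq using base by linarith
  qed
qed

lemma sum_plateau: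
  assumes W: "W > 0"
  shows "376 * W \<le> sum (plateau W) {1..500 * W}"
proof -
  have "sum (plateau W) {1..500 * W} =
      (\<Sum>x\<in>{1..500 * W}. (if x \<in> {103 * W..197 * W} then 1 else 0) + (if x \<in> {203 * W..297 * W} then 3 else 0))"
    using W by (intro sum.cong) (auto simp: plateau_def)
  also have "\<dots> = (\<Sum>x\<in>{1..500 * W} \<inter> {103 * W..197 * W}. 1) + (\<Sum>x\<in>{1..500 * W} \<inter> {203 * W..297 * W}. 3)"
    by (simp only: sum.distrib sum.inter_restrict[symmetric] finite_atLeastAtMost_int)
  also have "{1..500 * W} \<inter> {103 * W..197 * W} = {103 * W..197 * W}"
    using W by auto
  also have "{1..500 * W} \<inter> {203 * W..297 * W} = {203 * W..297 * W}"
    using W by auto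
  finally show ?thesis
    using W by simp
qed

text \<open>Complete covering would give a ruler the average weight
  \<open>15 * 376 / 500 = 11.28\<close>, which still exceeds 11 despite the margins cut from the
  plateaus.\<close>

lemma max_covered_6:
  assumes W: "W > 0"
  shows "51034 * max_covered 6 (500 * W) \<le> 25516860 * W"
proof -
  obtain b A where pack: "ruler_packing 6 (500 * W) b A"
    "max_covered 6 (500 * W) = card (\<Union>i\<in>{1..b}. pos_diffs (A i))"
    using max_covered_attained by blast
  define \<psi> where "\<psi> = (\<lambda>x. 34 * clip (300 * int W) (400 * int W) x + int W * plateau (int W) x)"
  have ruler: "sum \<psi> (pos_diffs B) \<le> - (50989 * int W)"
    if B: "golomb_ruler 6 B" "pos_diffs B \<subseteq> {1..int (500 * W)}" for B
  proof -
    obtain m :: "nat \<Rightarrow> int" where m: "\<And>i j. i < j \<Longrightarrow> j < 6 \<Longrightarrow> m i < m j"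
      "\<And>i j. i < j \<Longrightarrow> j < 6 \<Longrightarrow> m j - m i \<in> pos_diffs B"
      "\<And>f :: int \<Rightarrow> int. sum f (pos_diffs B) = (\<Sum>(i, j)\<in>{(i, j). i < j \<and> j < 6}. f (m j - m i))"
      by (rule golomb_ruler_marks[OF B(1)]) blast
    have P: "{(i, j). i < j \<and> j < (6::nat)} = {(0, 1), (1, 2), (2, 3), (3, 4), (4, 5), (0, 2), (1, 3), (2, 4), (3, 5),
        (0, 3), (1, 4), (2, 5), (0, 4), (1, 5), (0, 5)}"
    proof (intro equalityI subrelI)
      fix i j :: nat
      assume "(i, j) \<in> {(i, j). i < j \<and> j < 6}"
      then have "i < j" "j = 1 \<or> j = 2 \<or> j = 3 \<or> j = 4 \<or> j = 5"
        by auto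
      moreover from this have "i = 0 \<or> i = 1 \<or> i = 2 \<or> i = 3 \<or> i = 4"
        by linarith
      ultimately show "(i, j) \<in> {(0, 1), (1, 2), (2, 3), (3, 4), (4, 5), (0, 2), (1, 3), (2, 4), (3, 5),
          (0, 3), (1, 4), (2, 5), (0, 4), (1, 5), (0, 5)}"
        by (elim disjE) simp_all
    qed auto
    have "m 5 - m 0 \<le> 500 * int W"
      using m(2)[of 0 5] B(2) by auto
    moreover have "0 < m 1 - m 0" "0 < m 2 - m 1" "0 < m 3 - m 2" "0 < m 4 - m 3" "0 < m 5 - m 4"
      using m(1) by simp_all
    ultimately show ?thesis
      using six_mark_inequality[of "int W" "m 1 - m 0" "m 2 - m 1" "m 3 - m 2" "m 4 - m 3" "m 5 - m 4"] W
      unfolding m(3) P \<psi>_def by (simp add: add.assoc)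
  qed
  have M: "\<psi> x \<le> 3 * int W" for x
  proof -
    have "int W * plateau (int W) x \<le> int W * 3"
      by (intro mult_left_mono plateau_bounds(1)) simp
    then show ?thesis
      unfolding \<psi>_def using clip_bounds(3)[of "300 * int W" "400 * int W" x] by linarith
  qed
  have "sum \<psi> {1..int (500 * W)} =
      34 * sum (clip (int (300 * W)) (int (400 * W))) {1..int (500 * W)} + int W * sum (plateau (int W)) {1..500 * int W}"
    by (simp add: \<psi>_def sum.distrib sum_distrib_left)
  moreover have "2 * sum (clip (int (300 * W)) (int (400 * W))) {1..int (500 * W)} = - 100000 * (int W * int W) + 200 * int W"
    by (subst sum_clip) (auto simp: algebra_simps)
  moreover have "int W * (376 * int W) \<le> int W * sum (plateau (int W)) {1..500 * int W}"
    using W by (intro mult_left_mono sum_plateau) auto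
  ultimately have \<psi>: "- 1699624 * (int W * int W) \<le> sum \<psi> {1..int (500 * W)}"
    by simp
  have six: "6 choose 2 = (15 :: nat)"
    by (simp add: choose_two)
  have c: "card (\<Union>i\<in>{1..b}. pos_diffs (A i)) = b * 15"
    using test_function_bound(1)[OF pack(1) ruler M] unfolding six by simp
  have "int b * (50989 * int W) \<le> - sum \<psi> {1..int (500 * W)} + 3 * int W * (int (500 * W) - int (b * 15))"
    using test_function_bound(2)[OF pack(1) ruler M] unfolding six by simp
  also have "\<dots> \<le> 1701124 * (int W * int W) - 45 * (int b * int W)"
    using \<psi> by (simp add: algebra_simps)
  finally have "(51034 * int b) * int W \<le> (1701124 * int W) * int W"
    by (simp add: algebra_simps)
  then have "51034 * int b \<le> 1701124 * int W"
    using W by (simp only: mult_le_cancel_right split: if_splits)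
  then show ?thesis
    unfolding pack(2) c by simp
qed

section \<open>From bounds on multiples of a fixed number to the limit\<close>

lemma not_limit_one:
  fixes \<rho> :: real
  assumes "N > 0" "\<rho> < 1"
    and le: "\<And>V. V > 0 \<Longrightarrow> real (max_covered t (N * V)) \<le> \<rho> * real (N * V)"
  shows "\<not> (\<lambda>U. real (max_covered t U) / real U) \<longlonglongrightarrow> 1"
proof
  assume lim: "(\<lambda>U. real (max_covered t U) / real U) \<longlonglongrightarrow> 1"
  \<comment> \<open>It is enough to stay below 1 along one subsequence; \<open>Suc V\<close> avoids
    the quotient at \<open>U = 0\<close>.\<close>
  have "strict_mono (\<lambda>V. N * Suc V)"
    using assms(1) by (simp add: strict_mono_def)
  from LIMSEQ_subseq_LIMSEQ[OF lim this]
  have "(\<lambda>V. real (max_covered t (N * Suc V)) / real (N * Suc V)) \<longlonglongrightarrow> 1"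
    by (simp only: comp_def)
  moreover have "real (max_covered t (N * Suc V)) / real (N * Suc V) \<le> \<rho>" for V
  proof -
    have "real (N * Suc V) > 0"
      unfolding of_nat_0_less_iff using assms(1) by simp
    then show ?thesis
      using le[of "Suc V"] by (simp only: pos_divide_le_eq zero_less_Suc)
  qed
  ultimately have "1 \<le> \<rho>"
    by (intro LIMSEQ_le_const2) auto
  then show False
    using assms(2) by simp
qed

lemma not_limit_ge_6:
  assumes "t \<ge> 6"
  shows "\<not> (\<lambda>U. real (max_covered t U) / real U) \<longlonglongrightarrow> 1"
proof (cases "t = 6")
  case True
  \<comment> \<open>The denominator is \<open>51034 * 500\<close>, which rescales the integer bound
    to a proportion.\<close>
  have "real (max_covered 6 (500 * W)) \<le> 25516860 / 25517000 * real (500 * W)" if "W > 0" for W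
    using max_covered_6[OF that] by simp
  then show ?thesis
    unfolding True by (intro not_limit_one[of 500 "25516860 / 25517000"]) auto
next
  case False
  then have t: "t \<ge> 7"
    using assms by simp
  define X where "X = (2 * real t - 3)\<^sup>2 + 9"
  have "2 * real (t choose 2) = real (2 * (t choose 2))"
    by simp
  also have "2 * (t choose 2) = t * (t - 1)"
    unfolding choose_two by (intro dvd_mult_div_cancel) auto
  finally have N: "2 * real (t choose 2) = real t * (real t - 1)"
    using t by (simp add: of_nat_diff)
  \<comment> \<open>This product equals \<open>X - 6 * N\<close> with \<open>N = t choose 2\<close>.
    It vanishes at \<open>t = 6\<close>, which is why that case needs the finer weights.\<close>
  have "(real t - 3) * (real t - 6) > 0"
    using t by simp
  then have X: "X > 6 * real (t choose 2)"
    using N by (simp add: X_def power2_eq_square algebra_simps)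
  show ?thesis
  proof (rule not_limit_one)
    show "t choose 2 > 0"
      using t by simp
    show "X / (2 * X - 6 * real (t choose 2)) < 1"
      using X by (simp add: divide_less_eq)
    show "real (max_covered t ((t choose 2) * V)) \<le> X / (2 * X - 6 * real (t choose 2)) * real ((t choose 2) * V)" for V
      using max_covered_ge_7[OF t, of V] X unfolding X_def[symmetric] by (simp add: pos_le_divide_eq mult.commute)
  qed
qed

theorem theorem1p1:
  fixes t :: nat
  assumes "t \<ge> 3"
  shows "(\<lambda>U. real (max_covered t U) / real U) \<longlonglongrightarrow> 1 \<longleftrightarrow> 3 \<le> t \<and> t \<le> 5"
proof
  assume "(\<lambda>U. real (max_covered t U) / real U) \<longlonglongrightarrow> 1"
  then show "3 \<le> t \<and> t \<le> 5"
    using not_limit_ge_6[of t] assms by (cases "t \<ge> 6") auto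
next
  assume "3 \<le> t \<and> t \<le> 5"
  then consider "t = 3" | "t = 4" | "t = 5"
    by linarith
  then show "(\<lambda>U. real (max_covered t U) / real U) \<longlonglongrightarrow> 1"
    using limit_3 limit_4 limit_5 by cases simp_all
qed

end
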